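(* Let $n\ge 3$. The moduli space of all framed decorated ideal $n$-gons modulo the action of the Möbius group $\mathrm{PSL}_2(\mathbb R)$ is given by the pairwise distinct $n$-tuples $\{s_i\}_{i=1}^n$ of centers of horocycles in $\hat{\mathbb R}=\mathbb R\cup\{\infty\}$ together with their Euclidean diameters $\{\delta_i\}_{i=1}^n$; the pairs $\{(s_i,\delta_i):1\le i\le n\}$ are called the framed holographic coordinates. The action of $A=\begin{pmatrix}a&b\\c&d\end{pmatrix}\in \mathrm{PSL}_2(\mathbb R)$ on these coordinates is the usual right fractional linear action $$s_i\mapsto \frac{d s_i-b}{-c s_i+a}$$ on the $\{s_i\}_{i=1}^n$, while the $\{\delta_i\}_{i=1}^n$ scale by the derivative, so $$\delta_i\mapsto \frac{\delta_i}{(a-cs_i)^2}.$$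
   Context: $\mathbb D$ is the Poincaré disk with circle at infinity $\mathbb S^1$, $\mathcal U$ the upper half plane with ideal boundary $\hat{\mathbb R}$, and $C:(\mathcal U,\hat{\mathbb R})\to(\mathbb D,\mathbb S^1)$, $C(s)=\frac{s-i}{s+i}$, the Cayley transform. A decorated ideal $n$-gon is an ideal polygon with $n$ sides in the hyperbolic plane together with $n$ horocycles, one centered at each ideal vertex. A framing on an ideal polygon is an arbitrary element $(u,v,w)$ of $C_3=\{(u,v,w)\in(\mathbb S^1)^3: u,v,w \text{ pairwise distinct}\}$; $u,v,w$ need not be vertices of the polygon. The Möbius group acts on polygons, horocycles and framings simultaneously. Given an orbit of a decorated ideal $n$-gon in $\mathbb D$ with framing $(u,v,w)$, one transports it to $\mathcal U$ by $C^{-1}$ followed by the unique Möbius transformation sending $C^{-1}(u),C^{-1}(v),C^{-1}(w)$ to $0,\infty,1$ respectively. The coordinates $(s_i,\delta_i)$ of the resulting decorated ideal polygon in $\mathcal U$ are: $s_i\in\hat{\mathbb R}$, the ideal vertices (centers of the horocycles), and $\delta_i>0$, the Euclidean diameter of the horocycle centered at $s_i$ (if $s_i=\infty$, then $\delta_i=\delta_\infty$ denotes instead the $y$-coordinate of the horizontal horocycle centered at $\infty$). The stated formulas for the action on $(s_i,\delta_i)$ are for finite points.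
   Formalization: PSL_2(R) preserves the cyclic order of (u,v,w), so it cannot send every framing to (0,∞,1). The bijection with the coordinates is proved for each of the two orientations of framings modulo PSL_2(R), and for all framings modulo PGL_2(R). *)

theory Defs
  imports "HOL-Analysis.Analysis"
begin

section \<open>The two models and the Cayley transform\<close>

text \<open>
  The extended real line, ideal boundary of the upper half plane; \<open>None\<close> is the point at infinity.
\<close>
type_synonym rhat = "real option"

definition uhp :: "complex set" where
  "uhp = {z. Im z > 0}"

definition cayley :: "complex \<Rightarrow> complex" where
  "cayley z = (z - \<i>) / (z + \<i>)"

definition cayley_inv :: "complex \<Rightarrow> complex" where
  "cayley_inv w = \<i> * (1 + w) / (1 - w)"

definition cayley_bd :: "rhat \<Rightarrow> complex" where
  "cayley_bd s = (case s of None \<Rightarrow> 1 | Some x \<Rightarrow> cayley (of_real x))"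

text \<open>On the unit circle minus 1 the values of \<^const>\<open>cayley_inv\<close> are real.\<close>
definition cayley_bd_inv :: "complex \<Rightarrow> rhat" where
  "cayley_bd_inv u = (if u = 1 then None else Some (Re (cayley_inv u)))"


section \<open>Moebius transformations\<close>

definition mat2 :: "real \<Rightarrow> real \<Rightarrow> real \<Rightarrow> real \<Rightarrow> real^2^2" where
  "mat2 a b c d = vector [vector [a, b], vector [c, d]]"

text \<open>
  \<open>PSL\<^sub>2(\<real>)\<close> and \<open>PGL\<^sub>2(\<real>)\<close> are represented by matrices: a matrix
  and its nonzero multiples act in the same way, so the orbits are those of the projective groups.
\<close>
definition SL2R :: "(real^2^2) set" where
  "SL2R = {A. det A = 1}"

definition GL2R :: "(real^2^2) set" where
  "GL2R = {A. det A \<noteq> 0}"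

definition rhat_act :: "real^2^2 \<Rightarrow> rhat \<Rightarrow> rhat" where
  "rhat_act A s = (case s of
      None \<Rightarrow> if A$2$1 = 0 then None else Some (A$1$1 / A$2$1)
    | Some x \<Rightarrow> if A$2$1 * x + A$2$2 = 0 then None
                else Some ((A$1$1 * x + A$1$2) / (A$2$1 * x + A$2$2)))"

text \<open>
  The isometry of the upper half plane extending \<^const>\<open>rhat_act\<close>. For negative
  determinant this is the orientation reversing one, which involves complex conjugation.
\<close>
definition uhp_act :: "real^2^2 \<Rightarrow> complex \<Rightarrow> complex" where
  "uhp_act A z = (let w = (if det A > 0 then z else cnj z) in
     (of_real (A$1$1) * w + of_real (A$1$2)) / (of_real (A$2$1) * w + of_real (A$2$2)))"

definition disk_act :: "real^2^2 \<Rightarrow> complex \<Rightarrow> complex" where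
  "disk_act A = cayley \<circ> uhp_act A \<circ> cayley_inv"

definition circle_act :: "real^2^2 \<Rightarrow> complex \<Rightarrow> complex" where
  "circle_act A = cayley_bd \<circ> rhat_act A \<circ> cayley_bd_inv"


section \<open>Decorated ideal polygons\<close>

text \<open>
  The ideal polygon with ideal vertex set \<open>V\<close> on the unit circle is the hyperbolic convex
  hull of \<open>V\<close>: the intersection of all closed half planes of the disk that contain \<open>V\<close>
  in their ideal boundary. Every half plane is the image of the one that corresponds to
  \<open>Re z \<ge> 0\<close> in the upper half plane, which is bounded by the geodesic from 0 to infinity.
\<close>
definition ideal_polygon :: "complex set \<Rightarrow> complex set" where
  "ideal_polygon V = {z \<in> ball 0 1. \<forall>A\<in>SL2R.
     V \<subseteq> cayley_bd ` rhat_act A ` ({None} \<union> Some ` {0..}) \<longrightarrow>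
     z \<in> cayley ` uhp_act A ` {z \<in> uhp. Re z \<ge> 0}}"

text \<open>A horocycle: a circle in the disk tangent to the unit circle at its center \<open>u\<close>.\<close>
definition horocycle_at :: "complex \<Rightarrow> complex set \<Rightarrow> bool" where
  "horocycle_at u h \<longleftrightarrow> (\<exists>r::real. 0 < r \<and> r < 1 \<and> h = sphere ((1 - r) *\<^sub>R u) r - {u})"

text \<open>
  A decorated ideal polygon is the polygon with the list of its horocycles. The list enumerates
  the vertices in an arbitrary order, not necessarily the cyclic one.
\<close>
type_synonym decorated = "complex set \<times> complex set list"

definition decorated_ngons :: "nat \<Rightarrow> decorated set" where
  "decorated_ngons n = {(P, hs). \<exists>us. length us = n \<and> distinct us \<and> set us \<subseteq> sphere 0 1 \<and>
     P = ideal_polygon (set us) \<and> list_all2 horocycle_at us hs}"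

definition decorated_act :: "real^2^2 \<Rightarrow> decorated \<Rightarrow> decorated" where
  "decorated_act A = (\<lambda>(P, hs). (disk_act A ` P, map ((`) (disk_act A)) hs))"


section \<open>Framings and the moduli space\<close>

type_synonym framing = "complex \<times> complex \<times> complex"

definition C3 :: "framing set" where
  "C3 = {(u, v, w). {u, v, w} \<subseteq> sphere 0 1 \<and> u \<noteq> v \<and> v \<noteq> w \<and> u \<noteq> w}"

definition framing_act :: "real^2^2 \<Rightarrow> framing \<Rightarrow> framing" where
  "framing_act A = (\<lambda>(u, v, w). (circle_act A u, circle_act A v, circle_act A w))"

text \<open>1 for triples in counterclockwise order on the unit circle, -1 for clockwise ones.\<close>
definition framing_orientation :: "framing \<Rightarrow> real" where
  "framing_orientation = (\<lambda>(u, v, w). sgn (Im (cnj (v - u) * (w - u))))"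

type_synonym framed = "decorated \<times> framing"

definition framed_ngons :: "nat \<Rightarrow> framed set" where
  "framed_ngons n = decorated_ngons n \<times> C3"

definition orbit_rel :: "(real^2^2) set \<Rightarrow> nat \<Rightarrow> (framed \<times> framed) set" where
  "orbit_rel G n = {(x, y). x \<in> framed_ngons n \<and> y \<in> framed_ngons n \<and>
     (\<exists>A\<in>G. y = map_prod (decorated_act A) (framing_act A) x)}"

definition moduli_space :: "(real^2^2) set \<Rightarrow> nat \<Rightarrow> framed set set" where
  "moduli_space G n = framed_ngons n // orbit_rel G n"

text \<open>
  \<open>PSL\<^sub>2(\<real>)\<close> preserves the orientation of framings, so its moduli space splits
  into the part with counterclockwise and the part with clockwise framings. The triple
  \<open>(0, \<infinity>, 1)\<close> is mapped by the Cayley transform to the clockwise \<open>(-1, 1, -\<i>)\<close>.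
\<close>
definition moduli_part :: "real \<Rightarrow> nat \<Rightarrow> framed set set" where
  "moduli_part \<sigma> n = {m \<in> moduli_space SL2R n. \<forall>(X, F)\<in>m. framing_orientation F = \<sigma>}"


section \<open>Framed holographic coordinates\<close>

text \<open>
  The horocycle of the upper half plane with center \<open>s\<close> and Euclidean diameter \<open>\<delta>\<close>,
  respectively height \<open>\<delta>\<close> if its center is infinity.
\<close>
definition uhp_horocycle :: "rhat \<Rightarrow> real \<Rightarrow> complex set" where
  "uhp_horocycle s \<delta> = (case s of
      None \<Rightarrow> {z. Im z = \<delta>}
    | Some x \<Rightarrow> sphere (Complex x (\<delta> / 2)) (\<delta> / 2) - {of_real x})"

text \<open>
  \<open>B\<close> is the transformation normalizing the framing to \<open>(0, \<infinity>, 1)\<close>; it is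
  unique up to a scalar. Its determinant is negative if the framing is counterclockwise.
\<close>
definition framed_coords :: "framed \<Rightarrow> (rhat \<times> real) list" where
  "framed_coords = (\<lambda>((P, hs), (u, v, w)). THE cs. \<exists>B\<in>GL2R.
     rhat_act B (cayley_bd_inv u) = Some 0 \<and>
     rhat_act B (cayley_bd_inv v) = None \<and>
     rhat_act B (cayley_bd_inv w) = Some 1 \<and>
     list_all2 (\<lambda>h (s, \<delta>). \<delta> > 0 \<and> uhp_act B ` cayley_inv ` h = uhp_horocycle s \<delta>) hs cs)"

definition holographic_coords :: "framed set \<Rightarrow> (rhat \<times> real) list" where
  "holographic_coords m = the_elem (framed_coords ` m)"

definition coord_tuples :: "nat \<Rightarrow> (rhat \<times> real) list set" where
  "coord_tuples n = {cs. length cs = n \<and> distinct (map fst cs) \<and> (\<forall>(s, \<delta>)\<in>set cs. \<delta> > 0)}"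

definition relabel :: "(nat \<Rightarrow> nat) \<Rightarrow> framed set \<Rightarrow> framed set" where
  "relabel \<pi> m = apfst (apsnd (permute_list \<pi>)) ` m"


section \<open>The right action\<close>

text \<open>The framing \<open>B (0, \<infinity>, 1)\<close>, transported to the unit circle.\<close>
definition framing_of :: "real^2^2 \<Rightarrow> framing" where
  "framing_of B = (cayley_bd (rhat_act B (Some 0)), cayley_bd (rhat_act B None),
     cayley_bd (rhat_act B (Some 1)))"

text \<open>
  Since \<^const>\<open>framing_of\<close> identifies framings with invertible matrices up to scalars,
  the simultaneous Moebius action on framings is left multiplication, and right multiplication
  by \<open>A\<close> commutes with it. Changing only the framing by \<open>A\<close> from the right therefore
  acts on the moduli space. In terms of normalized representatives, with framing
  \<open>(0, \<infinity>, 1)\<close>, it moves the decorated polygon by the inverse of \<open>A\<close>.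
\<close>
definition reframe :: "real^2^2 \<Rightarrow> framing \<Rightarrow> framing" where
  "reframe A F = (THE F'. \<exists>B\<in>GL2R. F = framing_of B \<and> F' = framing_of (B ** A))"

definition right_act :: "real^2^2 \<Rightarrow> framed set \<Rightarrow> framed set" where
  "right_act A m = apsnd (reframe A) ` m"

end

theory Submission
  imports Defs
begin

text \<open>
  The proof linearizes the whole situation. A horocycle of the half plane corresponds to a nonzero
  vector \<open>v\<close> of the real plane up to sign, by the equation \<open>|v1 - v2 z|\<^sup>2 = Im z\<close>: its center is
  \<open>v1 / v2\<close> and its Euclidean diameter is \<open>1 / v2\<^sup>2\<close>. The isometry of an invertible matrix \<open>A\<close> maps
  this horocycle to that of \<open>A v\<close>, divided by the square root of \<open>|det A|\<close>
  (\<open>uhp_act_image_horo\<close>). The Cayley transform carries these horocycles to the Euclidean circles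
  inside the disk that are tangent to the unit circle (\<open>horocycle_at_iff_horo\<close>). The polygon is
  the hull of the centers and is mapped to the hull of their images by every isometry
  (\<open>disk_act_image_ideal_polygon\<close>). A decorated ideal polygon is therefore given by a list \<open>vs\<close> of
  vectors with pairwise distinct centers, on which matrices act linearly
  (\<open>decorated_ngons_eq\<close>, \<open>decorated_act_ngon_of\<close>).

  Moebius transformations act simply transitively on triples of distinct boundary points, so that
  a framing is the image of \<open>(0, \<infinity>, 1)\<close> under a matrix \<open>B\<close>, unique up to a scalar. A framed
  decorated polygon becomes a pair \<open>(vs, B)\<close>. An isometry \<open>A\<close> maps it to \<open>(A vs, A B)\<close>, and its
  coordinates are the centers and diameters of \<open>vs\<close> transformed by the inverse of \<open>B\<close>
  (\<open>framed_coords_eq\<close>). This is plainly a complete invariant for \<open>PGL\<^sub>2(\<real>)\<close>, and every tuple with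
  distinct centers and positive diameters occurs. The orientation of the framing is the sign of
  \<open>- det B\<close>; together with the coordinates it is a complete invariant for \<open>PSL\<^sub>2(\<real>)\<close>
  (\<open>orbit_rel_SL2R_iff\<close>). The bijections between moduli spaces and coordinate tuples follow.

  The right action of \<open>A\<close> replaces \<open>B\<close> by \<open>B A\<close>, and thus transforms the normalized vectors
  by the inverse of \<open>A\<close>, the matrix with rows \<open>(d, -b)\<close> and \<open>(-c, a)\<close>. The formula for the centers is
  the action of this matrix on quotients. The second entry of a vector is multiplied by \<open>a - c x\<close>,
  whence the formula for the diameters (\<open>right_act_coords\<close>).
\<close>

section \<open>Two by two matrices\<close>

lemma matrix_mult_nth_2: "(A ** B) $ i $ j = A$i$1 * B$1$j + A$i$2 * B$2$j"
  for A B :: "real^2^2"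
  by (simp add: matrix_matrix_mult_def sum_2)

lemma matrix_vector_mult_nth_2: "(A *v v) $ i = A$i$1 * v$1 + A$i$2 * v$2"
  for A :: "real^2^2"
  by (simp add: matrix_vector_mult_def sum_2)

lemma vec2_eq_iff: "v = w \<longleftrightarrow> v$1 = w$1 \<and> v$2 = w$2"
  for v w :: "'a^2"
  by (simp add: vec_eq_iff forall_2)

lemma mat2_nth [simp]:
  "mat2 a b c d $ 1 $ 1 = a" "mat2 a b c d $ 1 $ 2 = b"
  "mat2 a b c d $ 2 $ 1 = c" "mat2 a b c d $ 2 $ 2 = d"
  by (simp_all add: mat2_def)

lemma mat_1_nth_2 [simp]:
  "(mat 1 :: real^2^2) $ 1 $ 1 = 1" "(mat 1 :: real^2^2) $ 1 $ 2 = 0"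
  "(mat 1 :: real^2^2) $ 2 $ 1 = 0" "(mat 1 :: real^2^2) $ 2 $ 2 = 1"
  by (simp_all add: mat_def)

lemma det_scaleR_2: "det (k *\<^sub>R A) = k\<^sup>2 * det A" for A :: "real^2^2"
  by (simp add: det_2 power2_eq_square algebra_simps)

lemma pos_det_scaleR_SL2R:
  fixes A :: "real^2^2"
  assumes "det A > 0"
  obtains k where "k \<noteq> 0" "k *\<^sub>R A \<in> SL2R"
  using assms by (intro that[of "1 / sqrt (det A)"]) (simp_all add: SL2R_def det_scaleR_2 power_divide)

lemma GL2R_mult: "A \<in> GL2R \<Longrightarrow> B \<in> GL2R \<Longrightarrow> A ** B \<in> GL2R"
  by (simp add: GL2R_def det_mul)

lemma SL2R_subset_GL2R: "A \<in> SL2R \<Longrightarrow> A \<in> GL2R"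
  by (simp add: GL2R_def SL2R_def)

lemma SL2R_mult: "A \<in> SL2R \<Longrightarrow> B \<in> SL2R \<Longrightarrow> A ** B \<in> SL2R"
  by (simp add: SL2R_def det_mul)

lemma mat_1_in_SL2R: "mat 1 \<in> SL2R"
  by (simp add: SL2R_def)

lemma matrix_inv_GL2R:
  assumes "A \<in> GL2R"
  shows "A ** matrix_inv A = mat 1" "matrix_inv A ** A = mat 1" "matrix_inv A \<in> GL2R"
    "det (matrix_inv A) = 1 / det A"
proof -
  have "invertible A"
    using assms by (simp add: GL2R_def invertible_det_nz)
  then have "A ** matrix_inv A = mat 1 \<and> matrix_inv A ** A = mat 1"
    unfolding matrix_inv_def invertible_def by (rule someI_ex)
  then show 1: "A ** matrix_inv A = mat 1" and "matrix_inv A ** A = mat 1"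
    by blast+
  have "det A * det (matrix_inv A) = 1"
    using arg_cong[OF 1, of det] by (simp add: det_mul)
  then show "det (matrix_inv A) = 1 / det A" "matrix_inv A \<in> GL2R"
    using assms by (auto simp: GL2R_def field_simps)
qed

lemma matrix_inv_SL2R: "A \<in> SL2R \<Longrightarrow> matrix_inv A \<in> SL2R"
  using matrix_inv_GL2R(4)[of A] SL2R_subset_GL2R[of A] by (simp add: SL2R_def)

lemma matrix_inv_eqI:
  fixes A B :: "real^2^2"
  assumes "A ** B = mat 1"
  shows "matrix_inv B = A"
proof -
  have "det A * det B = 1"
    using arg_cong[OF assms, of det] by (simp add: det_mul)
  then have "B \<in> GL2R"
    by (auto simp: GL2R_def)
  then have "matrix_inv B = (A ** B) ** matrix_inv B" "A ** (B ** matrix_inv B) = A"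
    using assms by (simp_all add: matrix_inv_GL2R(1) matrix_mul_lid matrix_mul_rid)
  then show ?thesis
    by (metis matrix_mul_assoc)
qed

lemma matrix_inv_mult:
  assumes "A \<in> GL2R" "B \<in> GL2R"
  shows "matrix_inv (A ** B) = matrix_inv B ** matrix_inv A"
proof (rule matrix_inv_eqI)
  have "(matrix_inv B ** matrix_inv A) ** (A ** B) = matrix_inv B ** (matrix_inv A ** A) ** B"
    by (simp add: matrix_mul_assoc)
  then show "(matrix_inv B ** matrix_inv A) ** (A ** B) = mat 1"
    using assms by (simp add: matrix_inv_GL2R(2) matrix_mul_rid)
qed

lemma matrix_inv_mat2:
  "a * d - b * c = 1 \<Longrightarrow> matrix_inv (mat2 a b c d) = mat2 d (- b) (- c) a"
  by (rule matrix_inv_eqI) (simp add: vec2_eq_iff matrix_mult_nth_2 algebra_simps)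

lemma mult_nonzero_GL2R: "A \<in> GL2R \<Longrightarrow> v \<noteq> 0 \<Longrightarrow> A *v v \<noteq> 0"
  by (metis matrix_inv_GL2R(2) matrix_vector_mul_assoc matrix_vector_mul_lid matrix_vector_mult_0_right)

section \<open>Homogeneous coordinates on the ideal boundary\<close>

text \<open>
  Working with nonzero vectors up to scaling removes the case distinction at infinity: a matrix
  acts on boundary points by plain matrix multiplication, and two points agree iff the
  determinant \<open>cross\<close> of their vectors vanishes.
\<close>
definition proj :: "real^2 \<Rightarrow> rhat" where
  "proj v = (if v$2 = 0 then None else Some (v$1 / v$2))"

definition cross :: "real^2 \<Rightarrow> real^2 \<Rightarrow> real" where
  "cross v w = v$1 * w$2 - v$2 * w$1"

lemma vec2_nonzero: "v \<noteq> 0 \<longleftrightarrow> v$1 \<noteq> 0 \<or> v$2 \<noteq> 0" for v :: "real^2"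
  by (simp add: vec2_eq_iff)

lemma proj_eq_iff: "v \<noteq> 0 \<Longrightarrow> w \<noteq> 0 \<Longrightarrow> proj v = proj w \<longleftrightarrow> cross v w = 0"
  by (auto simp: proj_def cross_def vec2_nonzero field_simps)

lemma proj_scaleR: "k \<noteq> 0 \<Longrightarrow> proj (k *\<^sub>R v) = proj v"
  by (simp add: proj_def)

lemma cross_matrix_mult: "cross (A *v v) (A *v w) = det A * cross v w"
  by (simp add: cross_def matrix_vector_mult_nth_2 det_2 algebra_simps)

lemma proj_surj: obtains v where "v \<noteq> 0" "proj v = s"
proof (cases s)
  case None
  then show ?thesis
    using that[of "vector [1, 0]"] by (simp add: proj_def vec2_nonzero)
next
  case (Some x)
  then show ?thesis
    using that[of "vector [x, 1]"] by (simp add: proj_def vec2_nonzero)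
qed

lemma rhat_act_proj:
  assumes "v \<noteq> 0"
  shows "rhat_act A (proj v) = proj (A *v v)"
proof (cases "v$2 = 0")
  case True
  then show ?thesis
    using assms by (auto simp: rhat_act_def proj_def matrix_vector_mult_nth_2 vec2_nonzero)
next
  case False
  then have "A$i$1 * (v$1 / v$2) + A$i$2 = (A *v v)$i / v$2" for i
    by (simp add: matrix_vector_mult_nth_2 add_divide_distrib)
  then show ?thesis
    using False by (simp add: rhat_act_def proj_def)
qed

lemma rhat_act_mult: "B \<in> GL2R \<Longrightarrow> rhat_act (A ** B) s = rhat_act A (rhat_act B s)"
  by (rule proj_surj[of s])
    (auto simp: rhat_act_proj mult_nonzero_GL2R matrix_vector_mul_assoc)

lemma rhat_act_1 [simp]: "rhat_act (mat 1) s = s"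
  by (rule proj_surj[of s]) (auto simp: rhat_act_proj)

lemma rhat_act_inv:
  "A \<in> GL2R \<Longrightarrow> rhat_act A (rhat_act (matrix_inv A) s) = s"
  "A \<in> GL2R \<Longrightarrow> rhat_act (matrix_inv A) (rhat_act A s) = s"
  by (metis matrix_inv_GL2R rhat_act_mult rhat_act_1)+

lemma rhat_act_scaleR: "k \<noteq> 0 \<Longrightarrow> rhat_act (k *\<^sub>R A) s = rhat_act A s"
  by (rule proj_surj[of s])
    (auto simp: rhat_act_proj scaleR_matrix_vector_assoc[symmetric] proj_scaleR)

lemma rhat_act_eq_iff: "A \<in> GL2R \<Longrightarrow> rhat_act A s = rhat_act A t \<longleftrightarrow> s = t"
  by (metis rhat_act_inv(2))

text \<open>
  In homogeneous coordinates the Cayley transform \<open>(x - i) / (x + i)\<close> has no exceptional point: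
  it is \<open>v1 - i v2\<close> divided by its own conjugate, which also shows that it lies on the unit
  circle.
\<close>
lemma cayley_bd_proj:
  "v \<noteq> 0 \<Longrightarrow> cayley_bd (proj v) = Complex (v$1) (- v$2) / Complex (v$1) (v$2)"
  by (auto simp: proj_def cayley_bd_def cayley_def vec2_nonzero complex_eq_iff
      Re_divide Im_divide power2_eq_square divide_simps)

lemma cayley_bd_in_sphere: "cayley_bd s \<in> sphere 0 1"
proof -
  obtain v where v: "v \<noteq> 0" "proj v = s" by (rule proj_surj)
  have "cmod (Complex (v$1) (- v$2)) = cmod (Complex (v$1) (v$2))"
    by (simp add: cmod_def)
  moreover have "cmod (Complex (v$1) (v$2)) \<noteq> 0"
    using v by (auto simp: vec2_nonzero complex_eq_iff)
  ultimately show ?thesis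
    using v by (auto simp: cayley_bd_proj norm_divide)
qed

lemma cayley_bd_inv_cayley_bd [simp]: "cayley_bd_inv (cayley_bd s) = s"
proof (cases s)
  case (Some x)
  have "complex_of_real x + \<i> \<noteq> 0" by (simp add: complex_eq_iff)
  then have "cayley (of_real x) \<noteq> 1" "cayley_inv (cayley (of_real x)) = of_real x"
    by (simp_all add: cayley_def cayley_inv_def field_simps)
  then show ?thesis
    using Some by (simp add: cayley_bd_def cayley_bd_inv_def)
qed (simp add: cayley_bd_def cayley_bd_inv_def)

lemma cayley_cayley_inv: "w \<noteq> 1 \<Longrightarrow> cayley (cayley_inv w) = w"
  by (simp add: cayley_def cayley_inv_def divide_simps) (simp add: algebra_simps)

lemma cayley_bd_cayley_bd_inv:
  assumes "u \<in> sphere 0 1"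
  shows "cayley_bd (cayley_bd_inv u) = u"
proof (cases "u = 1")
  case False
  have 1: "(Re u)\<^sup>2 + (Im u)\<^sup>2 = 1"
    using assms by (simp add: cmod_def)
  have "Im (cayley_inv u) = 0"
  proof -
    have "Im (cayley_inv u) = (1 - ((Re u)\<^sup>2 + (Im u)\<^sup>2)) / ((1 - Re u)\<^sup>2 + (Im u)\<^sup>2)"
      by (simp add: cayley_inv_def Im_divide power2_eq_square algebra_simps)
    then show ?thesis using 1 by simp
  qed
  then have "of_real (Re (cayley_inv u)) = cayley_inv u"
    by (simp add: complex_eq_iff)
  moreover have "cayley (cayley_inv u) = u"
    using False by (rule cayley_cayley_inv)
  ultimately show ?thesis
    using False by (simp add: cayley_bd_def cayley_bd_inv_def)
qed (simp add: cayley_bd_def cayley_bd_inv_def)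

lemma cayley_bd_eq_iff: "cayley_bd s = cayley_bd t \<longleftrightarrow> s = t"
  by (metis cayley_bd_inv_cayley_bd)

section \<open>The Moebius action on the half plane and on the disk\<close>

lemma cayley_inv_cayley: "z \<in> uhp \<Longrightarrow> cayley_inv (cayley z) = z"
proof -
  assume "z \<in> uhp"
  then have "z + \<i> \<noteq> 0" by (auto simp: uhp_def complex_eq_iff)
  then have "1 + cayley z = 2 * z / (z + \<i>)" "1 - cayley z = 2 * \<i> / (z + \<i>)"
    by (simp_all add: cayley_def field_simps)
  then show ?thesis
    using \<open>z + \<i> \<noteq> 0\<close> by (simp add: cayley_inv_def)
qed

text \<open>
  The identity behind the Cayley transform: \<open>|z + i|\<^sup>2 - |z - i|\<^sup>2 = 4 Im z\<close>. It gives at once that the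
  disk corresponds to the half plane, and it turns equations of horocycles in one model into those
  in the other.
\<close>
lemma one_minus_norm_cayley:
  assumes "z \<noteq> - \<i>"
  shows "1 - (cmod (cayley z))\<^sup>2 = 4 * Im z / (cmod (z + \<i>))\<^sup>2"
proof -
  have "z + \<i> \<noteq> 0"
    using assms by (simp add: add_eq_0_iff2)
  then have "(cmod (z + \<i>))\<^sup>2 \<noteq> 0" by simp
  moreover have "(cmod (z + \<i>))\<^sup>2 - (cmod (z - \<i>))\<^sup>2 = 4 * Im z"
    unfolding cmod_power2 by (simp add: power2_eq_square algebra_simps)
  ultimately have "1 - (cmod (z - \<i>))\<^sup>2 / (cmod (z + \<i>))\<^sup>2 = 4 * Im z / (cmod (z + \<i>))\<^sup>2"
    by (metis diff_divide_distrib divide_self)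
  then show ?thesis
    by (simp add: cayley_def norm_divide power_divide)
qed

lemma cayley_in_ball: "z \<in> uhp \<Longrightarrow> cayley z \<in> ball 0 1"
proof -
  assume z: "z \<in> uhp"
  then have "z \<noteq> - \<i>" "z + \<i> \<noteq> 0" by (auto simp: uhp_def complex_eq_iff)
  then have "1 - (cmod (cayley z))\<^sup>2 > 0"
    using z by (simp add: one_minus_norm_cayley uhp_def)
  then show ?thesis by (simp add: power_less_one_iff abs_square_less_1)
qed

lemma cayley_inv_in_uhp: "w \<in> ball 0 1 \<Longrightarrow> cayley_inv w \<in> uhp"
proof -
  assume "w \<in> ball 0 1"
  then have w: "cmod w < 1" and "w \<noteq> 1" by auto
  define z where "z = cayley_inv w"
  have "z \<noteq> - \<i>"
    using \<open>w \<noteq> 1\<close> by (auto simp: z_def cayley_inv_def field_simps)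
  then have "4 * Im z / (cmod (z + \<i>))\<^sup>2 = 1 - (cmod w)\<^sup>2"
    using \<open>w \<noteq> 1\<close> by (simp add: one_minus_norm_cayley[symmetric] z_def cayley_cayley_inv)
  also have "\<dots> > 0"
    using w by (simp add: abs_square_less_1)
  finally have "Im z > 0"
    by (simp add: zero_less_divide_iff)
  then show ?thesis by (simp add: uhp_def z_def)
qed

lemma cayley_inv_image_cayley: "S \<subseteq> uhp \<Longrightarrow> cayley_inv ` cayley ` S = S"
  unfolding image_image by (subst image_cong[OF refl, of S _ id]) (auto simp: cayley_inv_cayley)

text \<open>
  The holomorphic formula alone. The isometry of a matrix of negative determinant applies it to the
  conjugate, and since the entries are real, conjugation commutes with it.
\<close>
definition moebius :: "real^2^2 \<Rightarrow> complex \<Rightarrow> complex" where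
  "moebius A z = (of_real (A$1$1) * z + of_real (A$1$2)) / (of_real (A$2$1) * z + of_real (A$2$2))"

lemma uhp_act_moebius: "uhp_act A z = moebius A (if det A > 0 then z else cnj z)"
  by (simp add: uhp_act_def moebius_def Let_def)

lemma moebius_cnj: "moebius A (cnj z) = cnj (moebius A z)"
  by (simp add: moebius_def)

lemma moebius_denom_nonzero:
  assumes "A \<in> GL2R" "Im z \<noteq> 0"
  shows "of_real (A$2$1) * z + of_real (A$2$2) \<noteq> 0"
  using assms by (auto simp: complex_eq_iff GL2R_def det_2)

lemma Im_moebius:
  "Im (moebius A z) = det A * Im z / (cmod (of_real (A$2$1) * z + of_real (A$2$2)))\<^sup>2"
  by (simp add: moebius_def Im_divide cmod_power2 det_2 algebra_simps)

lemma moebius_mult: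
  assumes "A \<in> GL2R" "B \<in> GL2R" "Im z \<noteq> 0"
  shows "moebius (A ** B) z = moebius A (moebius B z)"
proof -
  let ?d = "of_real (B$2$1) * z + of_real (B$2$2)"
  have d: "?d \<noteq> 0" by (rule moebius_denom_nonzero) fact+
  then have "Im (moebius B z) \<noteq> 0"
    using assms by (simp add: Im_moebius GL2R_def)
  then have e: "of_real (A$2$1) * moebius B z + of_real (A$2$2) \<noteq> 0"
    by (rule moebius_denom_nonzero[OF assms(1)])
  have "moebius A (moebius B z) = ((of_real (A$1$1) * moebius B z + of_real (A$1$2)) * ?d) /
      ((of_real (A$2$1) * moebius B z + of_real (A$2$2)) * ?d)"
    using d by (simp add: moebius_def[of A])
  moreover have "moebius B z * ?d = of_real (B$1$1) * z + of_real (B$1$2)"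
    using d by (simp add: moebius_def)
  then have "(of_real (A$1$1) * moebius B z + of_real (A$1$2)) * ?d =
      of_real ((A ** B)$1$1) * z + of_real ((A ** B)$1$2)"
    "(of_real (A$2$1) * moebius B z + of_real (A$2$2)) * ?d =
      of_real ((A ** B)$2$1) * z + of_real ((A ** B)$2$2)"
    by (simp_all add: distrib_right mult.assoc) (simp_all add: matrix_mult_nth_2 algebra_simps)
  ultimately show ?thesis by (simp only: moebius_def[of "A ** B"])
qed

lemma uhp_act_in_uhp: "A \<in> GL2R \<Longrightarrow> z \<in> uhp \<Longrightarrow> uhp_act A z \<in> uhp"
  using moebius_denom_nonzero[of A z] moebius_denom_nonzero[of A "cnj z"]
  by (auto simp: uhp_def uhp_act_moebius Im_moebius GL2R_def intro!: divide_pos_pos divide_neg_pos mult_neg_pos)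

lemma uhp_act_mult:
  assumes "A \<in> GL2R" "B \<in> GL2R" "z \<in> uhp"
  shows "uhp_act (A ** B) z = uhp_act A (uhp_act B z)"
  using assms
  by (auto simp: uhp_act_moebius det_mul uhp_def GL2R_def zero_less_mult_iff
      moebius_mult[unfolded GL2R_def] moebius_cnj)

lemma uhp_act_1 [simp]: "uhp_act (mat 1) z = z"
  by (simp add: uhp_act_def)

lemma uhp_act_inv:
  assumes "A \<in> GL2R" "z \<in> uhp"
  shows "uhp_act A (uhp_act (matrix_inv A) z) = z" "uhp_act (matrix_inv A) (uhp_act A z) = z"
  using assms by (metis matrix_inv_GL2R uhp_act_mult uhp_act_1)+

lemma uhp_act_scaleR: "k \<noteq> 0 \<Longrightarrow> uhp_act (k *\<^sub>R A) z = uhp_act A z"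
proof -
  assume k: "k \<noteq> 0"
  then have "det (k *\<^sub>R A) > 0 \<longleftrightarrow> det A > 0"
    by (simp add: det_scaleR_2 zero_less_mult_iff)
  moreover have "moebius (k *\<^sub>R A) w = moebius A w" for w
  proof -
    have "moebius (k *\<^sub>R A) w = (of_real k * (of_real (A$1$1) * w + of_real (A$1$2))) /
        (of_real k * (of_real (A$2$1) * w + of_real (A$2$2)))"
      by (simp add: moebius_def algebra_simps)
    then show ?thesis
      using k by (simp add: moebius_def)
  qed
  ultimately show ?thesis by (simp only: uhp_act_moebius)
qed

lemma disk_act_image: "S \<subseteq> uhp \<Longrightarrow> disk_act A ` cayley ` S = cayley ` uhp_act A ` S"
  by (simp add: disk_act_def image_comp[symmetric] cayley_inv_image_cayley del: o_apply)

lemma circle_act_cayley_bd: "circle_act A (cayley_bd s) = cayley_bd (rhat_act A s)"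
  by (simp add: circle_act_def)

section \<open>Horocycles as vectors\<close>

text \<open>
  A nonzero real vector encodes a horocycle: for \<open>v2 \<noteq> 0\<close> the equation reads
  \<open>|z - v1 / v2|\<^sup>2 = Im z / v2\<^sup>2\<close>, the circle of diameter \<open>1 / v2\<^sup>2\<close> tangent to the real line at
  \<open>v1 / v2\<close>, and for \<open>v2 = 0\<close> it is the horizontal line of height \<open>v1\<^sup>2\<close>. The vector is determined
  up to sign. This is the usual identification of the space of horocycles with the punctured plane
  modulo \<open>\<plusminus>1\<close>; it makes the isometries act linearly.
\<close>
definition horo :: "real^2 \<Rightarrow> complex set" where
  "horo v = {z \<in> uhp. (cmod (of_real (v$1) - of_real (v$2) * z))\<^sup>2 = Im z}"

definition coord_of :: "real^2 \<Rightarrow> rhat \<times> real" where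
  "coord_of v = (proj v, if v$2 = 0 then (v$1)\<^sup>2 else 1 / (v$2)\<^sup>2)"

text \<open>
  Division by the square root of the determinant makes scalar multiples of a matrix act in the same
  way up to sign, so that this is an action of \<open>PGL\<^sub>2(\<real>)\<close> on horocycles.
\<close>
definition vec_act :: "real^2^2 \<Rightarrow> real^2 \<Rightarrow> real^2" where
  "vec_act A v = (1 / sqrt \<bar>det A\<bar>) *\<^sub>R (A *v v)"

lemma horo_subset_uhp: "horo v \<subseteq> uhp"
  by (auto simp: horo_def)

lemma fst_coord_of [simp]: "fst (coord_of v) = proj v"
  by (simp add: coord_of_def)

lemma snd_coord_of_pos: "v \<noteq> 0 \<Longrightarrow> snd (coord_of v) > 0"
  by (auto simp: coord_of_def vec2_nonzero)

lemma coord_of_surj: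
  assumes "\<delta> > 0"
  obtains v where "v \<noteq> 0" "coord_of v = (s, \<delta>)"
proof (cases s)
  case None
  then show ?thesis
    using that[of "vector [sqrt \<delta>, 0]"] assms by (simp add: coord_of_def proj_def vec2_nonzero)
next
  case (Some x)
  then show ?thesis
    using that[of "vector [x / sqrt \<delta>, 1 / sqrt \<delta>]"] assms
    by (simp add: coord_of_def proj_def vec2_nonzero power_divide)
qed

lemma coord_of_uminus: "coord_of (- v) = coord_of v"
  by (simp add: coord_of_def proj_def)

text \<open>
  A point of the tangent circle other than the point of tangency satisfies
  \<open>0 < |z - x|\<^sup>2 = d Im z\<close>; this is why removing that point leaves exactly the part of the circle in
  the open half plane.
\<close>
lemma in_uhp_horocycle_Some_iff:
  assumes "d > 0"
  shows "z \<in> uhp_horocycle (Some x) d \<longleftrightarrow> z \<in> uhp \<and> (Re z - x)\<^sup>2 + (Im z)\<^sup>2 = d * Im z"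
proof -
  have "z \<in> uhp_horocycle (Some x) d \<longleftrightarrow> cmod (z - Complex x (d/2)) = d/2 \<and> z \<noteq> of_real x"
    by (auto simp: uhp_horocycle_def dist_norm norm_minus_commute)
  also have "cmod (z - Complex x (d/2)) = d/2 \<longleftrightarrow> (cmod (z - Complex x (d/2)))\<^sup>2 = (d/2)\<^sup>2"
    using assms by (subst power2_eq_iff_nonneg) auto
  also have "\<dots> \<longleftrightarrow> (Re z - x)\<^sup>2 + (Im z)\<^sup>2 = d * Im z"
    unfolding cmod_power2 by (auto simp: power2_eq_square algebra_simps)
  also have "(Re z - x)\<^sup>2 + (Im z)\<^sup>2 = d * Im z \<and> z \<noteq> of_real x \<longleftrightarrow>
      z \<in> uhp \<and> (Re z - x)\<^sup>2 + (Im z)\<^sup>2 = d * Im z"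
  proof -
    have "(Re z - x)\<^sup>2 + (Im z)\<^sup>2 > 0" if "z \<noteq> of_real x"
      using that by (auto simp: sum_power2_gt_zero_iff complex_eq_iff)
    then show ?thesis
      using assms by (auto simp: uhp_def zero_less_mult_iff)
  qed
  finally show ?thesis .
qed

lemma uhp_horocycle_coord_of:
  assumes "v \<noteq> 0"
  shows "case_prod uhp_horocycle (coord_of v) = horo v"
proof (cases "v$2 = 0")
  case True
  then have "(v$1)\<^sup>2 > 0" using assms by (simp add: vec2_nonzero)
  then show ?thesis
    using True by (auto simp: coord_of_def proj_def uhp_horocycle_def horo_def uhp_def)
next
  case False
  define x d where "x = v$1 / v$2" and "d = 1 / (v$2)\<^sup>2"
  have d: "d > 0" using False by (simp add: d_def)
  have "(Re z - x)\<^sup>2 + (Im z)\<^sup>2 = d * (cmod (of_real (v$1) - of_real (v$2) * z))\<^sup>2" for z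
  proof -
    have "of_real x - z = (of_real (v$1) - of_real (v$2) * z) / of_real (v$2)"
      using False by (simp add: x_def diff_divide_distrib)
    then have "(cmod (of_real x - z))\<^sup>2 = d * (cmod (of_real (v$1) - of_real (v$2) * z))\<^sup>2"
      by (simp add: norm_divide power_divide d_def)
    then show ?thesis
      by (simp add: cmod_power2[of "of_real x - z"] power2_commute[of x])
  qed
  then have "uhp_horocycle (Some x) d = horo v"
    using d by (auto simp: in_uhp_horocycle_Some_iff horo_def)
  then show ?thesis
    using False by (simp add: coord_of_def proj_def x_def d_def)
qed

text \<open>
  A horizontal line and a tangent circle differ because the height is constant on the former only.
  For two circles it suffices to insert the topmost point and the two points at half height of one
  of them into the equation of the other: the points at half height yield the center, then the
  topmost point yields the diameter.
\<close>
lemma uhp_horocycle_inj: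
  assumes "uhp_horocycle s \<delta> = uhp_horocycle s' \<delta>'" "\<delta> > 0" "\<delta>' > 0"
  shows "s = s' \<and> \<delta> = \<delta>'"
proof -
  note mem = in_uhp_horocycle_Some_iff uhp_def
  have memN: "z \<in> uhp_horocycle None d \<longleftrightarrow> Im z = d" for z d
    by (simp add: uhp_horocycle_def)
  have no: False if "uhp_horocycle None d = uhp_horocycle (Some x) e" "d > 0" "e > 0" for d x e
  proof -
    have "Complex x e \<in> uhp_horocycle None d" "Complex (x + e/2) (e/2) \<in> uhp_horocycle None d"
      unfolding that(1) using that by (simp_all add: mem power2_eq_square field_simps)
    then show False using that(3) by (simp add: memN)
  qed
  show ?thesis
  proof (cases s; cases s')
    assume s: "s = None" "s' = None"
    have "Complex 0 \<delta> \<in> uhp_horocycle s' \<delta>'"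
      unfolding assms(1)[symmetric] by (simp add: s memN)
    then have "\<delta> = \<delta>'" unfolding s by (simp add: memN)
    then show ?thesis using s by simp
  next
    fix x y assume s: "s = Some x" "s' = Some y"
    have "Complex (x + \<delta>/2) (\<delta>/2) \<in> uhp_horocycle s' \<delta>'"
      "Complex (x - \<delta>/2) (\<delta>/2) \<in> uhp_horocycle s' \<delta>'"
      "Complex x \<delta> \<in> uhp_horocycle s' \<delta>'"
      unfolding assms(1)[symmetric] using assms(2)
      by (simp_all add: s(1) mem power2_eq_square field_simps)
    then have 1: "(x + \<delta>/2 - y)\<^sup>2 + (\<delta>/2)\<^sup>2 = \<delta>' * (\<delta>/2)"
      "(x - \<delta>/2 - y)\<^sup>2 + (\<delta>/2)\<^sup>2 = \<delta>' * (\<delta>/2)" "(x - y)\<^sup>2 + \<delta>\<^sup>2 = \<delta>' * \<delta>"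
      using assms by (simp_all add: mem s)
    have "(x + \<delta>/2 - y)\<^sup>2 - (x - \<delta>/2 - y)\<^sup>2 = 2 * \<delta> * (x - y)"
      by (simp add: power2_eq_square algebra_simps)
    moreover have "(x + \<delta>/2 - y)\<^sup>2 - (x - \<delta>/2 - y)\<^sup>2 = 0"
      using 1 by linarith
    ultimately have "x = y" using assms(2) by simp
    then show ?thesis using 1 s assms by (simp add: power2_eq_square)
  next
    fix x assume "s = None" "s' = Some x"
    then show ?thesis using no assms by blast
  next
    fix x assume "s = Some x" "s' = None"
    then show ?thesis using no[OF _ assms(3,2)] assms(1) by metis
  qed
qed

lemma vec_act_nonzero: "A \<in> GL2R \<Longrightarrow> v \<noteq> 0 \<Longrightarrow> vec_act A v \<noteq> 0"
  by (simp add: vec_act_def mult_nonzero_GL2R) (simp add: GL2R_def)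

lemma vec_act_mult: "vec_act (A ** B) v = vec_act A (vec_act B v)"
  by (simp add: vec_act_def det_mul abs_mult real_sqrt_mult matrix_vector_mul_assoc[symmetric]
      matrix_vector_mult_scaleR)

lemma vec_act_1 [simp]: "vec_act (mat 1) v = v"
  by (simp add: vec_act_def)

lemma proj_vec_act: "A \<in> GL2R \<Longrightarrow> v \<noteq> 0 \<Longrightarrow> proj (vec_act A v) = rhat_act A (proj v)"
  by (simp add: vec_act_def proj_scaleR rhat_act_proj GL2R_def)

text \<open>
  With \<open>v' = A v\<close> and \<open>z' = (a z + b) / (c z + d)\<close> one has
  \<open>v'1 - v'2 z' = det A (v1 - v2 z) / (c z + d)\<close>, while \<open>Im z' = det A Im z / |c z + d|\<^sup>2\<close>. Hence the two
  sides of the equation of a horocycle scale by \<open>(det A)\<^sup>2\<close> and by \<open>det A\<close>, up to the common factor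
  \<open>1 / |c z + d|\<^sup>2\<close>, and the normalization of \<open>vec_act\<close> compensates the difference.
\<close>
lemma uhp_act_in_horo_iff:
  assumes A: "A \<in> GL2R" and z: "z \<in> uhp"
  shows "uhp_act A z \<in> horo (vec_act A v) \<longleftrightarrow> z \<in> horo v"
proof -
  \<comment> \<open>The conjugation for negative determinants changes neither side of the equation of a horocycle
    except for the sign of the imaginary part, which the sign of the determinant cancels.\<close>
  define w where "w = (if det A > 0 then z else cnj z)"
  define den where "den = of_real (A$2$1) * w + of_real (A$2$2)"
  have "Im w \<noteq> 0" using z by (auto simp: w_def uhp_def)
  then have den: "den \<noteq> 0"
    unfolding den_def by (rule moebius_denom_nonzero[OF A])
  have act: "uhp_act A z = moebius A w"
    by (simp add: uhp_act_moebius w_def)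
  have "det A * Im w = \<bar>det A\<bar> * Im z"
    by (auto simp: w_def)
  then have Im: "Im (moebius A w) = \<bar>det A\<bar> * Im z / (cmod den)\<^sup>2"
    by (simp add: Im_moebius den_def)
  have "(of_real ((A *v v)$1) - of_real ((A *v v)$2) * moebius A w) * den =
      of_real (det A) * (of_real (v$1) - of_real (v$2) * w)"
  proof -
    have "moebius A w * den = of_real (A$1$1) * w + of_real (A$1$2)"
      using den by (simp add: moebius_def den_def)
    then have "(of_real ((A *v v)$1) - of_real ((A *v v)$2) * moebius A w) * den =
        of_real ((A *v v)$1) * den - of_real ((A *v v)$2) * (of_real (A$1$1) * w + of_real (A$1$2))"
      by (simp add: left_diff_distrib mult.assoc)
    then show ?thesis
      by (simp add: den_def matrix_vector_mult_nth_2 det_2 algebra_simps)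
  qed
  then have "of_real ((A *v v)$1) - of_real ((A *v v)$2) * moebius A w =
      of_real (det A) * (of_real (v$1) - of_real (v$2) * w) / den"
    using den by (simp add: eq_divide_eq)
  moreover have "of_real (vec_act A v $ 1) - of_real (vec_act A v $ 2) * moebius A w =
      of_real (1 / sqrt \<bar>det A\<bar>) * (of_real ((A *v v)$1) - of_real ((A *v v)$2) * moebius A w)"
    by (simp add: vec_act_def algebra_simps)
  ultimately have "(cmod (of_real (vec_act A v $ 1) - of_real (vec_act A v $ 2) * moebius A w))\<^sup>2 =
      (det A)\<^sup>2 / \<bar>det A\<bar> * (cmod (of_real (v$1) - of_real (v$2) * w))\<^sup>2 / (cmod den)\<^sup>2"
    by (simp add: norm_mult norm_divide power_mult_distrib power_divide)
  also have "(det A)\<^sup>2 / \<bar>det A\<bar> = \<bar>det A\<bar>"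
    by (simp add: power2_eq_square abs_if)
  also have "cmod (of_real (v$1) - of_real (v$2) * w) = cmod (of_real (v$1) - of_real (v$2) * z)"
  proof -
    have "cmod (cnj (of_real (v$1) - of_real (v$2) * z)) = cmod (of_real (v$1) - of_real (v$2) * z)"
      by (rule complex_mod_cnj)
    then show ?thesis by (simp add: w_def)
  qed
  finally show ?thesis
    using z uhp_act_in_uhp[OF A z] den A by (simp add: act Im horo_def GL2R_def)
qed

lemma uhp_act_image_horo:
  assumes A: "A \<in> GL2R"
  shows "uhp_act A ` horo v = horo (vec_act A v)"
proof (intro equalityI subsetI)
  fix w assume w: "w \<in> horo (vec_act A v)"
  then have "w \<in> uhp" by (simp add: horo_def)
  then have "uhp_act (matrix_inv A) w \<in> uhp" "w = uhp_act A (uhp_act (matrix_inv A) w)"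
    using A by (simp_all add: uhp_act_in_uhp matrix_inv_GL2R uhp_act_inv)
  then show "w \<in> uhp_act A ` horo v"
    using w uhp_act_in_horo_iff[OF A, of "uhp_act (matrix_inv A) w" v] by auto
qed (auto simp: horo_def[of v] uhp_act_in_horo_iff[OF A])

text \<open>
  Both sides of the defining equation of \<open>horo v\<close> acquire the factor \<open>4 / |z + i|\<^sup>2\<close> under the Cayley
  transform; what remains is an equation in the distance to the center on the circle.
\<close>
lemma cayley_image_horo:
  assumes v: "v \<noteq> 0"
  shows "cayley ` horo v =
    {w \<in> ball 0 1. ((v$1)\<^sup>2 + (v$2)\<^sup>2) * (cmod (cayley_bd (proj v) - w))\<^sup>2 = 1 - (cmod w)\<^sup>2}"
    (is "_ = ?H")
proof -
  have iff: "z \<in> horo v \<longleftrightarrow> cayley z \<in> ?H" if z: "z \<in> uhp" for z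
  proof -
    have z': "z + \<i> \<noteq> 0" "z \<noteq> - \<i>" using z by (auto simp: uhp_def complex_eq_iff)
    have v': "Complex (v$1) (v$2) \<noteq> 0" using v by (auto simp: vec2_nonzero complex_eq_iff)
    have "Complex (v$1) (- v$2) / Complex (v$1) (v$2) - (z - \<i>) / (z + \<i>) =
        2 * \<i> * (of_real (v$1) - of_real (v$2) * z) / (Complex (v$1) (v$2) * (z + \<i>))"
      using z' v' by (simp add: diff_frac_eq) (simp add: complex_eq_iff algebra_simps)
    then have "cmod (cayley_bd (proj v) - cayley z) =
        2 * cmod (of_real (v$1) - of_real (v$2) * z) / (cmod (Complex (v$1) (v$2)) * cmod (z + \<i>))"
      by (simp add: cayley_bd_proj v cayley_def norm_divide norm_mult)
    then have "(cmod (cayley_bd (proj v) - cayley z))\<^sup>2 =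
        4 * (cmod (of_real (v$1) - of_real (v$2) * z))\<^sup>2 / (((v$1)\<^sup>2 + (v$2)\<^sup>2) * (cmod (z + \<i>))\<^sup>2)"
      by (simp add: power_divide power_mult_distrib cmod_power2)
    moreover have "(v$1)\<^sup>2 + (v$2)\<^sup>2 \<noteq> 0"
      using v by (simp add: vec2_nonzero sum_power2_eq_zero_iff)
    ultimately have "((v$1)\<^sup>2 + (v$2)\<^sup>2) * (cmod (cayley_bd (proj v) - cayley z))\<^sup>2 =
        4 * (cmod (of_real (v$1) - of_real (v$2) * z))\<^sup>2 / (cmod (z + \<i>))\<^sup>2"
      by simp
    then show ?thesis
      using z z' cayley_in_ball[OF z] one_minus_norm_cayley[OF z'(2)] by (simp add: horo_def)
  qed
  show ?thesis
  proof (intro equalityI subsetI)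
    fix w assume w: "w \<in> ?H"
    then have "w \<noteq> 1" by auto
    then have "w = cayley (cayley_inv w)" by (simp add: cayley_cayley_inv)
    moreover have "cayley_inv w \<in> uhp" using w by (intro cayley_inv_in_uhp) simp
    ultimately show "w \<in> cayley ` horo v"
      using w iff[of "cayley_inv w"] by auto
  next
    fix w assume "w \<in> cayley ` horo v"
    then obtain z where "z \<in> horo v" "w = cayley z" by blast
    then show "w \<in> ?H"
      using iff[of z] horo_subset_uhp by auto
  qed
qed

text \<open>
  Expanding \<open>|w - (1 - r) u|\<^sup>2 = r\<^sup>2\<close> with \<open>|u| = 1\<close> gives the equation on the right. Its form shows that
  the circle meets the unit circle only in \<open>u\<close>, and it is the one that \<open>cayley_image_horo\<close>
  gives for the Cayley images.
\<close>
lemma horocycle_at_iff: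
  assumes "u \<in> sphere 0 1"
  shows "horocycle_at u h \<longleftrightarrow>
    (\<exists>r. 0 < r \<and> r < 1 \<and> h = {w \<in> ball 0 1. (1 - r) / r * (cmod (u - w))\<^sup>2 = 1 - (cmod w)\<^sup>2})"
proof -
  have u: "(Re u)\<^sup>2 + (Im u)\<^sup>2 = 1" using assms by (simp add: cmod_def)
  have "sphere ((1 - r) *\<^sub>R u) r - {u} = {w \<in> ball 0 1. (1 - r) / r * (cmod (u - w))\<^sup>2 = 1 - (cmod w)\<^sup>2}"
    if r: "0 < r" "r < 1" for r
  proof -
    have "w \<in> sphere ((1 - r) *\<^sub>R u) r \<longleftrightarrow> (1 - r) / r * (cmod (u - w))\<^sup>2 = 1 - (cmod w)\<^sup>2" for w
    proof -
      have "w \<in> sphere ((1 - r) *\<^sub>R u) r \<longleftrightarrow> (cmod ((1 - r) *\<^sub>R u - w))\<^sup>2 = r\<^sup>2"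
        using r by (simp add: dist_norm power2_eq_iff_nonneg)
      also have "(cmod ((1 - r) *\<^sub>R u - w))\<^sup>2 - r\<^sup>2 =
          (1 - r)\<^sup>2 * ((Re u)\<^sup>2 + (Im u)\<^sup>2) - 2 * (1 - r) * (Re u * Re w + Im u * Im w) + (cmod w)\<^sup>2 - r\<^sup>2"
        unfolding cmod_power2 by (simp add: power2_eq_square algebra_simps)
      then have "(cmod ((1 - r) *\<^sub>R u - w))\<^sup>2 = r\<^sup>2 \<longleftrightarrow>
          (1 - r)\<^sup>2 - 2 * (1 - r) * (Re u * Re w + Im u * Im w) + (cmod w)\<^sup>2 - r\<^sup>2 = 0"
        unfolding u by (metis eq_iff_diff_eq_0 mult.right_neutral)
      also have "(1 - r)\<^sup>2 - 2 * (1 - r) * (Re u * Re w + Im u * Im w) + (cmod w)\<^sup>2 - r\<^sup>2 =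
          (1 - r) * ((Re u)\<^sup>2 + (Im u)\<^sup>2 - 2 * (Re u * Re w + Im u * Im w) + (cmod w)\<^sup>2) - r * (1 - (cmod w)\<^sup>2)"
        unfolding u by (simp add: power2_eq_square algebra_simps)
      also have "(Re u)\<^sup>2 + (Im u)\<^sup>2 - 2 * (Re u * Re w + Im u * Im w) + (cmod w)\<^sup>2 = (cmod (u - w))\<^sup>2"
        unfolding cmod_power2 by (simp add: power2_eq_square algebra_simps)
      finally show ?thesis
        using r by (auto simp: field_simps)
    qed
    moreover have "w \<in> ball 0 1 \<longleftrightarrow> w \<noteq> u" if "(1 - r) / r * (cmod (u - w))\<^sup>2 = 1 - (cmod w)\<^sup>2" for w
    proof -
      have "w \<in> ball 0 1 \<longleftrightarrow> 1 - (cmod w)\<^sup>2 > 0"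
        by (simp add: abs_square_less_1)
      then show ?thesis
        unfolding that[symmetric] using r by (auto simp: zero_less_mult_iff)
    qed
    ultimately show ?thesis
      by (simp only: set_eq_iff Diff_iff singleton_iff mem_Collect_eq) blast
  qed
  then show ?thesis
    unfolding horocycle_at_def by (intro iff_exI conj_cong refl) simp
qed

text \<open>
  The Euclidean radius \<open>r\<close> of a horocycle of the disk and the vector \<open>v\<close> are related by
  \<open>v1\<^sup>2 + v2\<^sup>2 = (1 - r) / r\<close>. Every positive number is of this form for exactly one \<open>r\<close> between 0 and 1,
  so the length of \<open>v\<close> can be adjusted to \<open>r\<close> and conversely.
\<close>
lemma horocycle_at_iff_horo:
  assumes "u \<in> sphere 0 1"
  shows "horocycle_at u h \<longleftrightarrow> (\<exists>v. v \<noteq> 0 \<and> u = cayley_bd (proj v) \<and> h = cayley ` horo v)"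
proof
  assume "horocycle_at u h"
  then obtain r where r: "0 < r" "r < 1"
    and h: "h = {w \<in> ball 0 1. (1 - r) / r * (cmod (u - w))\<^sup>2 = 1 - (cmod w)\<^sup>2}"
    by (auto simp: horocycle_at_iff[OF assms])
  obtain v0 where v0: "v0 \<noteq> 0" "proj v0 = cayley_bd_inv u"
    by (rule proj_surj)
  define N where "N = (v0$1)\<^sup>2 + (v0$2)\<^sup>2"
  have N: "N > 0" using v0 by (auto simp: N_def vec2_nonzero sum_power2_gt_zero_iff)
  define t where "t = sqrt ((1 - r) / r / N)"
  have t: "t > 0" "t\<^sup>2 * N = (1 - r) / r" using r N by (simp_all add: t_def)
  define v where "v = t *\<^sub>R v0"
  have N': "(v$1)\<^sup>2 + (v$2)\<^sup>2 = (1 - r) / r"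
    unfolding t(2)[symmetric] by (simp add: v_def N_def power_mult_distrib distrib_left)
  have v: "v \<noteq> 0" "u = cayley_bd (proj v)"
    using t v0 by (simp_all add: v_def proj_scaleR cayley_bd_cayley_bd_inv[OF assms])
  have "h = cayley ` horo v"
    unfolding h cayley_image_horo[OF v(1)] N' v(2)[symmetric] ..
  then show "\<exists>v. v \<noteq> 0 \<and> u = cayley_bd (proj v) \<and> h = cayley ` horo v"
    using v by blast
next
  assume "\<exists>v. v \<noteq> 0 \<and> u = cayley_bd (proj v) \<and> h = cayley ` horo v"
  then obtain v where v: "v \<noteq> 0" "u = cayley_bd (proj v)" "h = cayley ` horo v"
    by blast
  define N where "N = (v$1)\<^sup>2 + (v$2)\<^sup>2"
  have N: "N > 0" using v by (auto simp: N_def vec2_nonzero sum_power2_gt_zero_iff)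
  define r where "r = 1 / (1 + N)"
  have r: "(1 - r) / r = N" "0 < r" "r < 1"
    using N by (simp_all add: r_def field_simps)
  have "h = {w \<in> ball 0 1. (1 - r) / r * (cmod (u - w))\<^sup>2 = 1 - (cmod w)\<^sup>2}"
    unfolding r(1) N_def v(2,3) by (rule cayley_image_horo[OF v(1)])
  then show "horocycle_at u h"
    unfolding horocycle_at_iff[OF assms] using r(2,3) by blast
qed

section \<open>Ideal polygons\<close>

text \<open>
  The ideal boundary of \<open>half_plane\<close>, the model half plane to the right of the geodesic from 0 to
  infinity.
\<close>
definition half_line :: "rhat set" where
  "half_line = {None} \<union> Some ` {0..}"

definition half_plane :: "complex set" where
  "half_plane = {z \<in> uhp. Re z \<ge> 0}"

lemma involution_image:
  assumes "\<And>x. x \<in> S \<Longrightarrow> f x \<in> S" "\<And>x. x \<in> S \<Longrightarrow> f (f x) = x"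
  shows "f ` S = S"
  using assms by (metis image_subsetI image_eqI subsetI subset_antisym)

text \<open>
  The half planes in the definition of \<open>ideal_polygon\<close> are images under \<open>SL\<^sub>2(\<real>)\<close>. Orientation
  reversing isometries produce no further ones, because the model half plane has a reflection:
  inversion in the unit circle maps it to itself.
\<close>
lemma half_plane_eq_SL2R:
  assumes A: "A \<in> GL2R"
  obtains C where "C \<in> SL2R" "rhat_act C ` half_line = rhat_act A ` half_line"
    "uhp_act C ` half_plane = uhp_act A ` half_plane"
proof -
  \<comment> \<open>Inversion in the unit circle, which has determinant -1.\<close>
  define J where "J = mat2 0 1 1 0"
  have J: "J \<in> GL2R" "det J = - 1" by (simp_all add: J_def GL2R_def det_2)
  have JJ: "J ** J = mat 1" by (simp add: J_def vec2_eq_iff matrix_mult_nth_2)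
  have JR: "rhat_act J ` half_line = half_line"
  proof (rule involution_image)
    fix s assume s: "s \<in> half_line"
    have "rhat_act J s = (case s of None \<Rightarrow> Some 0 | Some x \<Rightarrow> if x = 0 then None else Some (1 / x))"
      by (simp add: rhat_act_def J_def split: option.split)
    then show "rhat_act J s \<in> half_line"
      using s by (auto simp: half_line_def split: if_splits)
    show "rhat_act J (rhat_act J s) = s"
      by (simp add: rhat_act_mult[OF J(1), symmetric] JJ)
  qed
  have JH: "uhp_act J ` half_plane = half_plane"
  proof (rule involution_image)
    fix z assume z: "z \<in> half_plane"
    have "Re (uhp_act J z) = Re z / ((Re z)\<^sup>2 + (Im z)\<^sup>2)"
      using J(2) by (simp add: uhp_act_def J_def Re_divide)
    then show "uhp_act J z \<in> half_plane"
      using z J(1) by (simp add: half_plane_def uhp_act_in_uhp)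
    show "uhp_act J (uhp_act J z) = z"
      using z J(1) by (simp add: half_plane_def uhp_act_mult[symmetric] JJ)
  qed
  define D where "D = (if det A > 0 then A else A ** J)"
  have DR: "rhat_act D ` half_line = rhat_act A ` half_line"
  proof -
    have "rhat_act (A ** J) ` half_line = rhat_act A ` rhat_act J ` half_line"
      by (simp add: image_image rhat_act_mult[OF J(1)])
    then show ?thesis by (simp add: D_def JR)
  qed
  have DH: "uhp_act D ` half_plane = uhp_act A ` half_plane"
  proof -
    have "uhp_act (A ** J) ` half_plane = uhp_act A ` uhp_act J ` half_plane"
      unfolding image_image by (rule image_cong) (simp_all add: half_plane_def uhp_act_mult[OF A J(1)])
    then show ?thesis by (simp add: D_def JH)
  qed
  have "det D > 0"
    using A J(2) by (auto simp: D_def det_mul GL2R_def)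
  then obtain k where k: "k \<noteq> 0" "k *\<^sub>R D \<in> SL2R"
    by (rule pos_det_scaleR_SL2R)
  have "rhat_act (k *\<^sub>R D) = rhat_act D" "uhp_act (k *\<^sub>R D) = uhp_act D"
    using k(1) by (simp_all add: fun_eq_iff rhat_act_scaleR uhp_act_scaleR)
  then show thesis
    using k(2) DR DH by (intro that[of "k *\<^sub>R D"]) (simp_all only:)
qed

text \<open>
  Allowing all of \<open>GL\<^sub>2(\<real>)\<close> makes the family of half planes visibly invariant under every isometry,
  also under those that reverse the orientation.
\<close>
lemma ideal_polygon_GL2R:
  "ideal_polygon V = {z \<in> ball 0 1. \<forall>A\<in>GL2R.
     V \<subseteq> cayley_bd ` rhat_act A ` half_line \<longrightarrow> z \<in> cayley ` uhp_act A ` half_plane}"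
  unfolding ideal_polygon_def half_line_def[symmetric] half_plane_def[symmetric]
proof (intro Collect_cong conj_cong refl iffI ballI)
  fix z and A :: "real^2^2"
  assume *: "\<forall>A\<in>SL2R. V \<subseteq> cayley_bd ` rhat_act A ` half_line \<longrightarrow>
     z \<in> cayley ` uhp_act A ` half_plane" and A: "A \<in> GL2R"
  obtain C where C: "C \<in> SL2R" "rhat_act C ` half_line = rhat_act A ` half_line"
    "uhp_act C ` half_plane = uhp_act A ` half_plane"
    using half_plane_eq_SL2R[OF A] .
  then show "V \<subseteq> cayley_bd ` rhat_act A ` half_line \<longrightarrow> z \<in> cayley ` uhp_act A ` half_plane"
    using bspec[OF * C(1)] by (simp only: C)
qed (simp add: SL2R_subset_GL2R)

lemma disk_act_in_ball: "A \<in> GL2R \<Longrightarrow> z \<in> ball 0 1 \<Longrightarrow> disk_act A z \<in> ball 0 1"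
  by (simp only: disk_act_def o_apply cayley_in_ball uhp_act_in_uhp cayley_inv_in_uhp)

lemma disk_act_inv:
  assumes "A \<in> GL2R" "z \<in> ball 0 1"
  shows "disk_act A (disk_act (matrix_inv A) z) = z"
proof -
  have "cayley_inv z \<in> uhp" "z \<noteq> 1"
    using assms(2) cayley_inv_in_uhp by auto
  then show ?thesis
    using assms(1)
    by (simp add: disk_act_def cayley_inv_cayley uhp_act_in_uhp matrix_inv_GL2R uhp_act_inv cayley_cayley_inv)
qed

lemma disk_act_in_ideal_polygon:
  assumes A: "A \<in> GL2R" and z: "z \<in> ideal_polygon (cayley_bd ` S)"
  shows "disk_act A z \<in> ideal_polygon (cayley_bd ` rhat_act A ` S)"
proof -
  have "z \<in> ball 0 1" using z by (simp add: ideal_polygon_def)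
  moreover have "disk_act A z \<in> cayley ` uhp_act C ` half_plane"
    if C: "C \<in> GL2R" and sub: "cayley_bd ` rhat_act A ` S \<subseteq> cayley_bd ` rhat_act C ` half_line" for C
  proof -
    let ?D = "matrix_inv A ** C"
    have D: "?D \<in> GL2R" using A C by (simp add: GL2R_mult matrix_inv_GL2R)
    have "rhat_act A ` S \<subseteq> rhat_act C ` half_line"
      using sub inj_image_subset_iff[of cayley_bd] by (simp add: inj_def cayley_bd_eq_iff)
    then have "rhat_act (matrix_inv A) ` rhat_act A ` S \<subseteq> rhat_act (matrix_inv A) ` rhat_act C ` half_line"
      by (rule image_mono)
    moreover have "rhat_act (matrix_inv A) ` rhat_act A ` S = S"
      using A by (simp add: image_image rhat_act_inv)
    moreover have "rhat_act (matrix_inv A) ` rhat_act C ` half_line = rhat_act ?D ` half_line"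
      using C by (simp add: image_image rhat_act_mult)
    ultimately have "cayley_bd ` S \<subseteq> cayley_bd ` rhat_act ?D ` half_line"
      by (simp only: image_mono)
    then have "z \<in> cayley ` uhp_act ?D ` half_plane"
      using z D unfolding ideal_polygon_GL2R by blast
    then obtain h where h: "h \<in> half_plane" "z = cayley (uhp_act ?D h)" by blast
    have "h \<in> uhp" using h(1) by (simp add: half_plane_def)
    have "disk_act A z = cayley (uhp_act A (uhp_act ?D h))"
      using h(2) \<open>h \<in> uhp\<close> D by (simp add: disk_act_def cayley_inv_cayley uhp_act_in_uhp)
    also have "uhp_act A (uhp_act ?D h) = uhp_act (A ** ?D) h"
      using \<open>h \<in> uhp\<close> A D by (simp add: uhp_act_mult)
    also have "A ** ?D = C"
      using A by (simp add: matrix_mul_assoc matrix_inv_GL2R)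
    finally show ?thesis using h by blast
  qed
  ultimately show ?thesis
    unfolding ideal_polygon_GL2R using disk_act_in_ball[OF A] by blast
qed

lemma disk_act_image_ideal_polygon:
  assumes A: "A \<in> GL2R"
  shows "disk_act A ` ideal_polygon (cayley_bd ` S) = ideal_polygon (cayley_bd ` rhat_act A ` S)"
proof (intro equalityI subsetI)
  fix w assume w: "w \<in> ideal_polygon (cayley_bd ` rhat_act A ` S)"
  then have "disk_act A (disk_act (matrix_inv A) w) = w"
    by (intro disk_act_inv[OF A]) (simp add: ideal_polygon_def)
  moreover have "rhat_act (matrix_inv A) ` rhat_act A ` S = S"
    using A by (simp add: image_image rhat_act_inv)
  then have "disk_act (matrix_inv A) w \<in> ideal_polygon (cayley_bd ` S)"
    using disk_act_in_ideal_polygon[OF matrix_inv_GL2R(3)[OF A] w] by simp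
  ultimately show "w \<in> disk_act A ` ideal_polygon (cayley_bd ` S)"
    by force
qed (use disk_act_in_ideal_polygon[OF A] in blast)

text \<open>
  Redundant data are left out: the polygon is the hull of the centers, and the centers are part of
  the horocycles, so a list of vectors determines the whole decorated polygon.
\<close>
definition ngon_of :: "(real^2) list \<Rightarrow> decorated" where
  "ngon_of vs = (ideal_polygon (cayley_bd ` proj ` set vs), map (\<lambda>v. cayley ` horo v) vs)"

definition vertex_lists :: "nat \<Rightarrow> (real^2) list set" where
  "vertex_lists n = {vs. length vs = n \<and> 0 \<notin> set vs \<and> distinct (map proj vs)}"

lemma decorated_ngons_eq: "decorated_ngons n = ngon_of ` vertex_lists n"
proof (intro equalityI subsetI)
  fix X assume "X \<in> decorated_ngons n"
  then obtain us hs where us: "length us = n" "distinct us" "set us \<subseteq> sphere 0 1"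
    "list_all2 horocycle_at us hs" and X: "X = (ideal_polygon (set us), hs)"
    by (auto simp: decorated_ngons_def)
  have len: "length hs = n" using us list_all2_lengthD by metis
  have "\<exists>v. v \<noteq> 0 \<and> us ! i = cayley_bd (proj v) \<and> hs ! i = cayley ` horo v" if "i < n" for i
  proof -
    have "us ! i \<in> sphere 0 1" using us that nth_mem by blast
    then show ?thesis
      using horocycle_at_iff_horo us that list_all2_nthD by metis
  qed
  then obtain f where f: "\<And>i. i < n \<Longrightarrow>
      f i \<noteq> 0 \<and> us ! i = cayley_bd (proj (f i)) \<and> hs ! i = cayley ` horo (f i)"
    by metis
  define vs where "vs = map f [0..<n]"
  have "us = map cayley_bd (map proj vs)" "hs = map (\<lambda>v. cayley ` horo v) vs"
    using us(1) len f by (auto simp: vs_def intro!: nth_equalityI)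
  moreover have "length vs = n" "0 \<notin> set vs" using f by (auto simp: vs_def)
  ultimately have "vs \<in> vertex_lists n" "X = ngon_of vs"
    using us(2) X by (simp_all add: vertex_lists_def ngon_of_def image_image distinct_map del: map_map)
  then show "X \<in> ngon_of ` vertex_lists n" by blast
next
  fix X assume "X \<in> ngon_of ` vertex_lists n"
  then obtain vs where vs: "vs \<in> vertex_lists n" "X = ngon_of vs" by blast
  define us where "us = map cayley_bd (map proj vs)"
  have "distinct us"
    using vs(1) unfolding us_def vertex_lists_def
    by (subst distinct_map) (auto simp: cayley_bd_eq_iff inj_on_def)
  moreover have "horocycle_at (cayley_bd (proj v)) (cayley ` horo v)" if "v \<in> set vs" for v
  proof -
    have "v \<noteq> 0" using that vs(1) by (auto simp: vertex_lists_def)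
    then show ?thesis
      unfolding horocycle_at_iff_horo[OF cayley_bd_in_sphere] by (intro exI[of _ v]) simp
  qed
  then have "list_all2 horocycle_at us (map (\<lambda>v. cayley ` horo v) vs)"
    by (simp add: us_def list_all2_conv_all_nth)
  moreover have "set us \<subseteq> sphere 0 1" unfolding us_def using cayley_bd_in_sphere by auto
  moreover have "length us = n" using vs(1) by (simp add: us_def vertex_lists_def)
  moreover have "X = (ideal_polygon (set us), map (\<lambda>v. cayley ` horo v) vs)"
    by (simp add: vs(2) ngon_of_def us_def image_image)
  ultimately show "X \<in> decorated_ngons n"
    unfolding decorated_ngons_def by blast
qed

lemma vec_act_vertex_lists:
  assumes "A \<in> GL2R" "vs \<in> vertex_lists n"
  shows "map (vec_act A) vs \<in> vertex_lists n"
proof -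
  have "v \<noteq> 0" if "v \<in> set vs" for v
    using assms(2) that by (auto simp: vertex_lists_def)
  then have "map proj (map (vec_act A) vs) = map (rhat_act A) (map proj vs)" "0 \<notin> set (map (vec_act A) vs)"
    using assms(1) vec_act_nonzero[OF assms(1)] by (auto simp: proj_vec_act)
  moreover have "distinct (map (rhat_act A) (map proj vs))"
    using assms by (subst distinct_map) (auto simp: vertex_lists_def rhat_act_eq_iff inj_on_def)
  ultimately show ?thesis
    using assms(2) by (simp add: vertex_lists_def del: map_map)
qed

lemma decorated_act_ngon_of:
  assumes "A \<in> GL2R" "0 \<notin> set vs"
  shows "decorated_act A (ngon_of vs) = ngon_of (map (vec_act A) vs)"
proof -
  have "v \<noteq> 0" if "v \<in> set vs" for v using assms(2) that by auto
  then have "rhat_act A ` proj ` set vs = proj ` vec_act A ` set vs"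
    using assms(1) by (auto simp: image_image proj_vec_act intro!: image_cong)
  moreover have "disk_act A ` cayley ` horo v = cayley ` horo (vec_act A v)" for v
    by (simp add: disk_act_image[OF horo_subset_uhp] uhp_act_image_horo[OF assms(1)])
  ultimately show ?thesis
    by (simp add: decorated_act_def ngon_of_def disk_act_image_ideal_polygon[OF assms(1)])
qed

text \<open>
  The sign of the vectors is invisible in the decorated polygon: it depends only on the centers and
  diameters.
\<close>
lemma ngon_of_cong:
  assumes "map coord_of vs = map coord_of ws" "0 \<notin> set vs" "0 \<notin> set ws"
  shows "ngon_of vs = ngon_of ws"
proof -
  have "map proj vs = map fst (map coord_of vs)" "map proj ws = map fst (map coord_of ws)" by simp_all
  then have "proj ` set vs = proj ` set ws"
    using assms(1) by (metis image_set)
  moreover have "horo v = case_prod uhp_horocycle (coord_of v)" if "v \<in> set vs \<union> set ws" for v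
    using that assms(2,3) by (intro uhp_horocycle_coord_of[symmetric]) auto
  then have "map horo vs = map (case_prod uhp_horocycle) (map coord_of vs)"
    "map horo ws = map (case_prod uhp_horocycle) (map coord_of ws)"
    unfolding map_map by (auto intro!: map_cong simp del: split_paired_All)
  then have "map ((`) cayley) (map horo vs) = map ((`) cayley) (map horo ws)"
    using assms(1) by simp
  ultimately show ?thesis
    by (simp add: ngon_of_def comp_def)
qed

section \<open>Framings\<close>

lemma rhat_act_fixes_imp_scalar:
  assumes "rhat_act C (Some 0) = Some 0" "rhat_act C None = None" "rhat_act C (Some 1) = Some 1"
  obtains k where "k \<noteq> 0" "C = k *\<^sub>R mat 1"
proof -
  have "C$2$1 = 0" using assms(2) by (auto simp: rhat_act_def split: if_splits)
  moreover have "C$2$2 \<noteq> 0" "C$1$2 = 0"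
    using assms(1) by (auto simp: rhat_act_def split: if_splits)
  moreover from this have "C$1$1 = C$2$2"
    using assms(3) \<open>C$2$1 = 0\<close> by (auto simp: rhat_act_def split: if_splits)
  ultimately show thesis
    by (intro that[of "C$2$2"]) (simp_all add: vec2_eq_iff)
qed

lemma scaleR_matrix_mult: "(k *\<^sub>R A) ** B = k *\<^sub>R (A ** B)" "A ** (k *\<^sub>R B) = k *\<^sub>R (A ** B)"
  for A B :: "real^2^2"
  by (simp_all add: vec2_eq_iff matrix_mult_nth_2 algebra_simps)

lemma framing_of_scaleR: "k \<noteq> 0 \<Longrightarrow> framing_of (k *\<^sub>R B) = framing_of B"
  by (simp add: framing_of_def rhat_act_scaleR)

text \<open>
  A Moebius transformation that fixes 0, infinity and 1 is the identity. Together with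
  \<open>framing_of_surj\<close> this identifies framings with \<open>PGL\<^sub>2(\<real>)\<close>.
\<close>
lemma framing_of_eq_imp_scalar:
  assumes "framing_of B = framing_of B'" "B \<in> GL2R" "B' \<in> GL2R"
  obtains k where "k \<noteq> 0" "B' = k *\<^sub>R B"
proof -
  have eq: "rhat_act B s = rhat_act B' s" if "s \<in> {Some 0, None, Some 1}" for s
    using assms(1) that by (auto simp: framing_of_def cayley_bd_eq_iff)
  have "rhat_act (matrix_inv B ** B') s = s" if "s \<in> {Some 0, None, Some 1}" for s
    using eq[OF that] assms(2,3) by (metis rhat_act_mult rhat_act_inv(2))
  then obtain k where k: "k \<noteq> 0" "matrix_inv B ** B' = k *\<^sub>R mat 1"
    by (rule_tac rhat_act_fixes_imp_scalar[of "matrix_inv B ** B'"]) auto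
  have "B' = B ** (matrix_inv B ** B')"
    using assms(2) by (simp add: matrix_mul_assoc matrix_inv_GL2R)
  also have "\<dots> = k *\<^sub>R B"
    by (simp add: k(2) scaleR_matrix_mult matrix_mul_rid)
  finally show thesis using k(1) that by blast
qed

lemma framing_of_in_C3: "B \<in> GL2R \<Longrightarrow> framing_of B \<in> C3"
  unfolding framing_of_def C3_def using cayley_bd_in_sphere
  by (simp add: cayley_bd_eq_iff rhat_act_eq_iff)

text \<open>
  With vectors \<open>p, q, r\<close> for the three points, rescale \<open>q\<close> and \<open>p\<close> by Cramer's rule such that their sum is
  \<open>r\<close>. The matrix with these columns maps infinity, 0 and 1 to the points of \<open>q\<close>, \<open>p\<close> and \<open>r\<close>; distinctness
  makes it invertible.
\<close>
lemma framing_of_surj: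
  assumes "F \<in> C3"
  obtains B where "B \<in> GL2R" "F = framing_of B"
proof -
  obtain u v w where F: "F = (u, v, w)" "u \<in> sphere 0 1" "v \<in> sphere 0 1" "w \<in> sphere 0 1"
    "u \<noteq> v" "v \<noteq> w" "u \<noteq> w"
    using assms by (auto simp: C3_def)
  have "\<exists>p. p \<noteq> 0 \<and> cayley_bd (proj p) = x" if "x \<in> sphere 0 1" for x
    using proj_surj[of "cayley_bd_inv x"] cayley_bd_cayley_bd_inv[OF that] by metis
  then obtain p q r where pqr: "p \<noteq> 0" "q \<noteq> 0" "r \<noteq> 0"
    "u = cayley_bd (proj p)" "v = cayley_bd (proj q)" "w = cayley_bd (proj r)"
    using F by metis
  then have ne: "cross p q \<noteq> 0" "cross q r \<noteq> 0" "cross p r \<noteq> 0"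
    using F(5-7) by (auto simp: proj_eq_iff[symmetric])
  define \<alpha> \<beta> where "\<alpha> = cross r p / cross q p" and "\<beta> = cross q r / cross q p"
  have qp: "cross q p \<noteq> 0" "cross r p \<noteq> 0"
    using ne(1,3) by (auto simp: cross_def mult.commute)
  have ab: "\<alpha> \<noteq> 0" "\<beta> \<noteq> 0" using ne qp by (auto simp: \<alpha>_def \<beta>_def)
  have r: "\<alpha> *\<^sub>R q + \<beta> *\<^sub>R p = r"
  proof -
    have "cross r p * q$i + cross q r * p$i = cross q p * r$i" for i :: 2
      using exhaust_2[of i] by (auto simp: cross_def algebra_simps)
    then have "(cross r p * q$i + cross q r * p$i) / cross q p = r$i" for i :: 2
      using qp by simp
    then show ?thesis
      by (simp add: vec_eq_iff \<alpha>_def \<beta>_def add_divide_distrib)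
  qed
  define B where "B = mat2 (\<alpha> * q$1) (\<beta> * p$1) (\<alpha> * q$2) (\<beta> * p$2)"
  have B: "B \<in> GL2R"
  proof -
    have "det B = \<alpha> * \<beta> * cross q p"
      by (simp add: B_def det_2 cross_def algebra_simps)
    then show ?thesis using ab qp by (simp add: GL2R_def)
  qed
  have "B *v vector [1, 0] = \<alpha> *\<^sub>R q" "B *v vector [0, 1] = \<beta> *\<^sub>R p" "B *v vector [1, 1] = r"
    by (simp_all add: r[symmetric] vec2_eq_iff matrix_vector_mult_nth_2 B_def)
  moreover have "rhat_act B (proj x) = proj (B *v x)" if "x \<noteq> 0" for x
    using that by (rule rhat_act_proj)
  moreover have "proj (vector [1, 0]) = None" "proj (vector [0, 1]) = Some 0" "proj (vector [1, 1]) = Some 1"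
    "vector [1, 0] \<noteq> (0 :: real^2)" "vector [0, 1] \<noteq> (0 :: real^2)" "vector [1, 1] \<noteq> (0 :: real^2)"
    by (simp_all add: proj_def vec2_nonzero)
  ultimately have "rhat_act B None = proj q" "rhat_act B (Some 0) = proj p" "rhat_act B (Some 1) = proj r"
    using ab by (metis proj_scaleR)+
  then have "F = framing_of B"
    by (simp add: F(1) framing_of_def pqr)
  with B show thesis by (rule that)
qed

lemma framing_act_framing_of: "B \<in> GL2R \<Longrightarrow> framing_act A (framing_of B) = framing_of (A ** B)"
  by (simp add: framing_act_def framing_of_def circle_act_cayley_bd rhat_act_mult)

text \<open>
  With \<open>P = p1 + i p2\<close> and likewise \<open>Q\<close>, \<open>R\<close>, the chord from the first point to the second is
  \<open>2 i cross q p / (Q P)\<close>, and that to the third is \<open>2 i cross r p / (R P)\<close>. The conjugate of the former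
  times the latter is a positive multiple of \<open>cross q p * cross r p * Q * cnj R\<close>, and the imaginary
  part of \<open>Q * cnj R\<close> is the third cross.
\<close>
lemma framing_orientation_cayley_bd:
  assumes "p \<noteq> 0" "q \<noteq> 0" "r \<noteq> 0"
  shows "framing_orientation (cayley_bd (proj p), cayley_bd (proj q), cayley_bd (proj r)) =
    sgn (cross q p * cross r p * cross r q)"
proof -
  define P Q R where "P = Complex (p$1) (p$2)" and "Q = Complex (q$1) (q$2)" and "R = Complex (r$1) (r$2)"
  have nz: "P \<noteq> 0" "Q \<noteq> 0" "R \<noteq> 0"
    using assms by (auto simp: P_def Q_def R_def complex_eq_iff vec2_nonzero)
  have scale: "Im (of_real a * z / of_real b) = a * Im z / b" for a b z
    by (simp add: Im_divide_of_real)
  have bd: "cayley_bd (proj p) = cnj P / P" "cayley_bd (proj q) = cnj Q / Q" "cayley_bd (proj r) = cnj R / R"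
    using assms by (simp_all add: cayley_bd_proj P_def Q_def R_def complex_cnj)
  have "cnj Q * P - cnj P * Q = 2 * \<i> * of_real (cross q p)" "cnj R * P - cnj P * R = 2 * \<i> * of_real (cross r p)"
    by (simp_all add: P_def Q_def R_def cross_def complex_eq_iff)
  then have d: "cnj Q / Q - cnj P / P = 2 * \<i> * of_real (cross q p) / (Q * P)"
    "cnj R / R - cnj P / P = 2 * \<i> * of_real (cross r p) / (R * P)"
    using nz by (simp_all add: diff_frac_eq)
  have "cnj (cnj Q / Q - cnj P / P) * (cnj R / R - cnj P / P) =
      of_real (4 * cross q p * cross r p) / (cnj Q * cnj P * (R * P))"
    unfolding d by (simp add: mult.assoc mult.left_commute)
  also have "\<dots> = of_real (4 * cross q p * cross r p) * (Q * cnj R) / ((cnj Q * Q) * (cnj P * P) * (cnj R * R))"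
    using nz by (simp add: field_simps)
  also have "(cnj Q * Q) * (cnj P * P) * (cnj R * R) = of_real ((cmod Q)\<^sup>2 * (cmod P)\<^sup>2 * (cmod R)\<^sup>2)"
    by (simp only: of_real_mult complex_norm_square mult_ac)
  finally have "Im (cnj (cnj Q / Q - cnj P / P) * (cnj R / R - cnj P / P)) =
      4 * cross q p * cross r p * Im (Q * cnj R) / ((cmod Q)\<^sup>2 * (cmod P)\<^sup>2 * (cmod R)\<^sup>2)"
    by (simp only: scale)
  also have "Im (Q * cnj R) = cross r q"
    by (simp add: Q_def R_def cross_def)
  finally have "Im (cnj (cnj Q / Q - cnj P / P) * (cnj R / R - cnj P / P)) =
      (4 / ((cmod Q)\<^sup>2 * (cmod P)\<^sup>2 * (cmod R)\<^sup>2)) * (cross q p * cross r p * cross r q)"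
    by simp
  moreover have "4 / ((cmod Q)\<^sup>2 * (cmod P)\<^sup>2 * (cmod R)\<^sup>2) > 0"
    using nz by simp
  ultimately show ?thesis
    by (simp only: framing_orientation_def prod.case bd sgn_mult sgn_pos mult_1_left)
qed

text \<open>
  Each of the three crosses is multiplied by \<open>det B\<close>, so the sign changes with the cube of the
  determinant; the minus sign comes from \<open>(0, \<infinity>, 1)\<close> being clockwise.
\<close>
lemma framing_orientation_framing_of:
  assumes B: "B \<in> GL2R"
  shows "framing_orientation (framing_of B) = - sgn (det B)"
proof -
  define e1 e2 :: "real^2" where "e1 = vector [1, 0]" and "e2 = vector [0, 1]"
  have e: "e1 \<noteq> 0" "e2 \<noteq> 0" "e1 + e2 \<noteq> 0" "proj e1 = None" "proj e2 = Some 0" "proj (e1 + e2) = Some 1"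
    "cross e1 e2 = 1" "cross (e1 + e2) e2 = 1" "cross (e1 + e2) e1 = - 1"
    by (simp_all add: e1_def e2_def proj_def cross_def vec2_nonzero)
  have "framing_of B = (cayley_bd (proj (B *v e2)), cayley_bd (proj (B *v e1)),
      cayley_bd (proj (B *v (e1 + e2))))"
    unfolding framing_of_def e(4-6)[symmetric]
    by (simp add: rhat_act_proj[OF e(1)] rhat_act_proj[OF e(2)] rhat_act_proj[OF e(3)])
  moreover have "framing_orientation \<dots> = sgn (det B * det B * - det B)"
    by (subst framing_orientation_cayley_bd)
      (simp_all only: mult_nonzero_GL2R[OF B] e cross_matrix_mult not_False_eq_True mult_1_right mult_minus_right)
  ultimately show ?thesis
    using B by (simp add: sgn_mult GL2R_def)
qed

section \<open>Framed decorated polygons and their coordinates\<close>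

abbreviation moebius_move :: "real^2^2 \<Rightarrow> framed \<Rightarrow> framed" where
  "moebius_move A \<equiv> map_prod (decorated_act A) (framing_act A)"

lemma vertex_lists_nonzero: "vs \<in> vertex_lists n \<Longrightarrow> 0 \<notin> set vs"
  by (simp add: vertex_lists_def)

lemma framed_ngonsE:
  assumes "x \<in> framed_ngons n"
  obtains vs B where "vs \<in> vertex_lists n" "B \<in> GL2R" "x = (ngon_of vs, framing_of B)"
proof -
  have "x \<in> ngon_of ` vertex_lists n \<times> C3"
    using assms by (simp add: framed_ngons_def decorated_ngons_eq)
  then obtain X F where x: "x = (X, F)" "X \<in> ngon_of ` vertex_lists n" "F \<in> C3"
    by blast
  then show thesis
    using that framing_of_surj[of F] by blast
qed

lemma framed_ngonsI:
  "vs \<in> vertex_lists n \<Longrightarrow> B \<in> GL2R \<Longrightarrow> (ngon_of vs, framing_of B) \<in> framed_ngons n"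
  by (simp add: framed_ngons_def decorated_ngons_eq framing_of_in_C3)

lemma moebius_move_eq:
  "A \<in> GL2R \<Longrightarrow> vs \<in> vertex_lists n \<Longrightarrow> B \<in> GL2R \<Longrightarrow>
    moebius_move A (ngon_of vs, framing_of B) = (ngon_of (map (vec_act A) vs), framing_of (A ** B))"
  by (simp add: decorated_act_ngon_of vertex_lists_nonzero framing_act_framing_of)

lemma moebius_move_in_framed_ngons:
  "A \<in> GL2R \<Longrightarrow> x \<in> framed_ngons n \<Longrightarrow> moebius_move A x \<in> framed_ngons n"
  by (erule framed_ngonsE) (simp only: moebius_move_eq framed_ngonsI vec_act_vertex_lists GL2R_mult)

lemma moebius_move_scaleR:
  assumes "k \<noteq> 0"
  shows "moebius_move (k *\<^sub>R A) x = moebius_move A x"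
proof -
  have "disk_act (k *\<^sub>R A) = disk_act A" "circle_act (k *\<^sub>R A) = circle_act A"
    using assms by (simp_all add: fun_eq_iff disk_act_def circle_act_def uhp_act_scaleR rhat_act_scaleR)
  then show ?thesis
    by (simp add: decorated_act_def framing_act_def)
qed

text \<open>
  The reason why the normalizing transformation only needs to be known up to a scalar.
\<close>
lemma coord_of_vec_act_scaleR:
  assumes "k \<noteq> 0"
  shows "coord_of (vec_act (k *\<^sub>R A) v) = coord_of (vec_act A v)"
proof -
  have "vec_act (k *\<^sub>R A) v = sgn k *\<^sub>R vec_act A v"
    using assms
    by (simp add: vec_act_def det_scaleR_2 abs_mult real_sqrt_mult scaleR_matrix_vector_assoc[symmetric] sgn_if)
  then show ?thesis
    using assms by (cases "k > 0") (simp_all add: coord_of_uminus)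
qed

lemma horocycles_coords_iff:
  assumes "B \<in> GL2R" "0 \<notin> set vs"
  shows "list_all2 (\<lambda>h (s, \<delta>). \<delta> > 0 \<and> uhp_act B ` cayley_inv ` h = uhp_horocycle s \<delta>)
      (map (\<lambda>v. cayley ` horo v) vs) cs \<longleftrightarrow> cs = map (\<lambda>v. coord_of (vec_act B v)) vs"
proof -
  have "(case c of (s, \<delta>) \<Rightarrow> \<delta> > 0 \<and> uhp_act B ` cayley_inv ` cayley ` horo v = uhp_horocycle s \<delta>) \<longleftrightarrow>
      c = coord_of (vec_act B v)" if "v \<in> set vs" for v c
  proof -
    have v: "vec_act B v \<noteq> 0" using that assms by (metis vec_act_nonzero)
    have "uhp_act B ` cayley_inv ` cayley ` horo v = horo (vec_act B v)"
      by (simp add: cayley_inv_image_cayley[OF horo_subset_uhp] uhp_act_image_horo[OF assms(1)])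
    also have "\<dots> = uhp_horocycle (fst (coord_of (vec_act B v))) (snd (coord_of (vec_act B v)))"
      using uhp_horocycle_coord_of[OF v] by (simp only: case_prod_unfold)
    finally show ?thesis
      using uhp_horocycle_inj[of "fst (coord_of (vec_act B v))" "snd (coord_of (vec_act B v))" "fst c" "snd c"]
        snd_coord_of_pos[OF v] by (auto simp: case_prod_unfold prod_eq_iff)
  qed
  then have "list_all2 (\<lambda>h (s, \<delta>). \<delta> > 0 \<and> uhp_act B ` cayley_inv ` h = uhp_horocycle s \<delta>)
      (map (\<lambda>v. cayley ` horo v) vs) cs \<longleftrightarrow> list_all2 (\<lambda>v c. c = coord_of (vec_act B v)) vs cs"
    unfolding list_all2_map1 by (rule list.rel_cong[OF refl refl]) blast
  also have "\<dots> \<longleftrightarrow> cs = map (\<lambda>v. coord_of (vec_act B v)) vs"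
    by (auto simp: list_all2_conv_all_nth list_eq_iff_nth_eq)
  finally show ?thesis .
qed

text \<open>
  The framing is \<open>B (0, \<infinity>, 1)\<close>, so the normalizing transformations are the multiples of the inverse
  of \<open>B\<close>. They all lead to the same coordinates, which gives a meaning to the definite description.
\<close>
lemma framed_coords_eq:
  assumes B: "B \<in> GL2R" and vs: "0 \<notin> set vs"
  shows "framed_coords (ngon_of vs, framing_of B) = map (\<lambda>v. coord_of (vec_act (matrix_inv B) v)) vs"
proof -
  define normalizes where "normalizes C \<longleftrightarrow> rhat_act C (rhat_act B (Some 0)) = Some 0 \<and>
     rhat_act C (rhat_act B None) = None \<and> rhat_act C (rhat_act B (Some 1)) = Some 1" for C
  have "framed_coords (ngon_of vs, framing_of B) = (THE cs. \<exists>C\<in>GL2R. normalizes C \<and>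
      list_all2 (\<lambda>h (s, \<delta>). \<delta> > 0 \<and> uhp_act C ` cayley_inv ` h = uhp_horocycle s \<delta>)
      (map (\<lambda>v. cayley ` horo v) vs) cs)"
    by (simp add: framed_coords_def ngon_of_def framing_of_def normalizes_def conj_assoc)
  also have "\<dots> = (THE cs. \<exists>C\<in>GL2R. normalizes C \<and> cs = map (\<lambda>v. coord_of (vec_act C v)) vs)"
    using horocycles_coords_iff[OF _ vs] by (intro arg_cong[of _ _ The] ext bex_cong refl) simp
  also have "\<dots> = map (\<lambda>v. coord_of (vec_act (matrix_inv B) v)) vs"
  proof (rule the_equality)
    show "\<exists>C\<in>GL2R. normalizes C \<and>
        map (\<lambda>v. coord_of (vec_act (matrix_inv B) v)) vs = map (\<lambda>v. coord_of (vec_act C v)) vs"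
      using B by (intro bexI[of _ "matrix_inv B"]) (simp_all add: normalizes_def rhat_act_inv matrix_inv_GL2R)
  next
    fix cs assume "\<exists>C\<in>GL2R. normalizes C \<and> cs = map (\<lambda>v. coord_of (vec_act C v)) vs"
    then obtain C where C: "C \<in> GL2R" "normalizes C" "cs = map (\<lambda>v. coord_of (vec_act C v)) vs" by blast
    obtain k where k: "k \<noteq> 0" "C ** B = k *\<^sub>R mat 1"
      using C(2) rhat_act_fixes_imp_scalar[of "C ** B"] by (auto simp: normalizes_def rhat_act_mult[OF B])
    have "C = (C ** B) ** matrix_inv B"
      using B by (simp add: matrix_mul_assoc[symmetric] matrix_inv_GL2R matrix_mul_rid)
    also have "\<dots> = k *\<^sub>R matrix_inv B"
      by (simp add: k(2) scaleR_matrix_mult matrix_mul_lid)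
    finally show "cs = map (\<lambda>v. coord_of (vec_act (matrix_inv B) v)) vs"
      using C(3) k(1) by (simp add: coord_of_vec_act_scaleR)
  qed
  finally show ?thesis .
qed

text \<open>
  Replacing the vectors \<open>vs\<close> by \<open>A vs\<close> and \<open>B\<close> by \<open>A B\<close> does not change the result of applying the
  inverse of the matrix to the vectors: the factors \<open>A\<close> cancel.
\<close>
lemma framed_coords_moebius_move:
  assumes A: "A \<in> GL2R" and x: "x \<in> framed_ngons n"
  shows "framed_coords (moebius_move A x) = framed_coords x"
proof -
  obtain vs B where v: "vs \<in> vertex_lists n" "B \<in> GL2R" "x = (ngon_of vs, framing_of B)"
    using x by (rule framed_ngonsE)
  have "vec_act (matrix_inv (A ** B)) (vec_act A v) = vec_act (matrix_inv B) v" for v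
  proof -
    have "vec_act (matrix_inv (A ** B)) (vec_act A v) = vec_act (matrix_inv B ** (matrix_inv A ** A)) v"
      by (simp add: matrix_inv_mult[OF A v(2)] vec_act_mult matrix_mul_assoc)
    then show ?thesis by (simp add: matrix_inv_GL2R[OF A] matrix_mul_rid)
  qed
  then show ?thesis
    unfolding v(3) moebius_move_eq[OF A v(1,2)]
      framed_coords_eq[OF GL2R_mult[OF A v(2)] vertex_lists_nonzero[OF vec_act_vertex_lists[OF A v(1)]]]
      framed_coords_eq[OF v(2) vertex_lists_nonzero[OF v(1)]]
    by simp
qed

lemma framing_orientation_moebius_move:
  assumes A: "A \<in> GL2R" and x: "x \<in> framed_ngons n"
  shows "framing_orientation (snd (moebius_move A x)) = sgn (det A) * framing_orientation (snd x)"
proof -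
  obtain vs B where v: "vs \<in> vertex_lists n" "B \<in> GL2R" "x = (ngon_of vs, framing_of B)"
    using x by (rule framed_ngonsE)
  then show ?thesis
    unfolding v(3) moebius_move_eq[OF A v(1,2)]
    using A by (simp add: framing_orientation_framing_of GL2R_mult det_mul sgn_mult)
qed

lemma framing_orientation_cases:
  assumes "x \<in> framed_ngons n"
  shows "framing_orientation (snd x) \<in> {1, - 1}"
proof -
  obtain vs B where v: "vs \<in> vertex_lists n" "B \<in> GL2R" "x = (ngon_of vs, framing_of B)"
    using assms by (rule framed_ngonsE)
  have "sgn (det B) = 1 \<or> sgn (det B) = - 1"
    using v(2) by (cases "det B" "0 :: real" rule: linorder_cases) (simp_all add: GL2R_def)
  then show ?thesis
    unfolding v(3) snd_conv framing_orientation_framing_of[OF v(2)] by auto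
qed

text \<open>
  The converse of invariance: if normalizing by \<open>B\<close> and by \<open>C\<close> leads to the same coordinates, then
  normalizing by the one and undoing the normalization by the other carries \<open>x\<close> to \<open>y\<close>.
\<close>
lemma framed_coords_eq_imp_moebius_move:
  assumes x: "x \<in> framed_ngons n" and y: "y \<in> framed_ngons n" and eq: "framed_coords x = framed_coords y"
  obtains A where "A \<in> GL2R" "y = moebius_move A x"
proof -
  obtain vs B where v: "vs \<in> vertex_lists n" "B \<in> GL2R" "x = (ngon_of vs, framing_of B)"
    using x by (rule framed_ngonsE)
  obtain ws C where w: "ws \<in> vertex_lists n" "C \<in> GL2R" "y = (ngon_of ws, framing_of C)"
    using y by (rule framed_ngonsE)
  define A where "A = C ** matrix_inv B"
  have A: "A \<in> GL2R" using v w by (simp add: A_def GL2R_mult matrix_inv_GL2R)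
  let ?vs = "map (vec_act (matrix_inv B)) vs" and ?ws = "map (vec_act (matrix_inv C)) ws"
  have V: "?vs \<in> vertex_lists n" "?ws \<in> vertex_lists n"
    by (rule vec_act_vertex_lists[OF matrix_inv_GL2R(3)[OF v(2)] v(1)],
        rule vec_act_vertex_lists[OF matrix_inv_GL2R(3)[OF w(2)] w(1)])
  have "map coord_of ?vs = map coord_of ?ws"
    using eq unfolding v(3) w(3) framed_coords_eq[OF v(2) vertex_lists_nonzero[OF v(1)]]
      framed_coords_eq[OF w(2) vertex_lists_nonzero[OF w(1)]] by (simp add: comp_def)
  then have "ngon_of ?vs = ngon_of ?ws"
    by (rule ngon_of_cong[OF _ vertex_lists_nonzero[OF V(1)] vertex_lists_nonzero[OF V(2)]])
  then have "ngon_of (map (vec_act C) ?vs) = ngon_of (map (vec_act C) ?ws)"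
    unfolding decorated_act_ngon_of[OF w(2) vertex_lists_nonzero[OF V(1)], symmetric]
      decorated_act_ngon_of[OF w(2) vertex_lists_nonzero[OF V(2)], symmetric] by (rule arg_cong)
  moreover have "map (vec_act C) ?vs = map (vec_act A) vs"
    by (simp add: A_def vec_act_mult)
  moreover have "map (vec_act C) ?ws = ws"
    using w(2) by (simp add: vec_act_mult[symmetric] matrix_inv_GL2R comp_def)
  ultimately have "ngon_of (map (vec_act A) vs) = ngon_of ws"
    by (simp only:)
  moreover have "A ** B = C"
    using v(2) by (simp add: A_def matrix_mul_assoc[symmetric] matrix_inv_GL2R matrix_mul_rid)
  ultimately have "y = moebius_move A x"
    unfolding v(3) w(3) moebius_move_eq[OF A v(1,2)] by (simp only:)
  with A show thesis by (rule that)
qed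

lemma orbit_rel_GL2R_iff:
  "(x, y) \<in> orbit_rel GL2R n \<longleftrightarrow>
    x \<in> framed_ngons n \<and> y \<in> framed_ngons n \<and> framed_coords x = framed_coords y"
proof -
  have "(\<exists>A\<in>GL2R. y = moebius_move A x) \<longleftrightarrow> framed_coords x = framed_coords y"
    if xy: "x \<in> framed_ngons n" "y \<in> framed_ngons n"
  proof
    assume "\<exists>A\<in>GL2R. y = moebius_move A x"
    then obtain A where "A \<in> GL2R" "y = moebius_move A x" by blast
    then show "framed_coords x = framed_coords y"
      by (simp only: framed_coords_moebius_move[OF _ xy(1)])
  next
    assume "framed_coords x = framed_coords y"
    then obtain A where "A \<in> GL2R" "y = moebius_move A x"
      by (rule framed_coords_eq_imp_moebius_move[OF xy])
    then show "\<exists>A\<in>GL2R. y = moebius_move A x" by (rule bexI[rotated])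
  qed
  then show ?thesis
    unfolding orbit_rel_def mem_Collect_eq prod.case by blast
qed

text \<open>
  The coordinates are a complete invariant for \<open>GL\<^sub>2(\<real>)\<close>. The connecting matrix multiplies the
  orientation of the framing by the sign of its determinant; if this sign is positive, the matrix
  can be rescaled to determinant 1.
\<close>
lemma orbit_rel_SL2R_iff:
  "(x, y) \<in> orbit_rel SL2R n \<longleftrightarrow>
    x \<in> framed_ngons n \<and> y \<in> framed_ngons n \<and> framed_coords x = framed_coords y \<and>
    framing_orientation (snd x) = framing_orientation (snd y)" (is "_ \<longleftrightarrow> ?R")
proof
  assume "(x, y) \<in> orbit_rel SL2R n"
  then obtain A where A: "A \<in> SL2R" "y = moebius_move A x" and xy: "x \<in> framed_ngons n" "y \<in> framed_ngons n"
    unfolding orbit_rel_def mem_Collect_eq prod.case by blast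
  have "det A = 1" using A(1) by (simp add: SL2R_def)
  then show ?R
    using xy framed_coords_moebius_move[OF SL2R_subset_GL2R[OF A(1)] xy(1)]
      framing_orientation_moebius_move[OF SL2R_subset_GL2R[OF A(1)] xy(1)]
    by (simp only: A(2)[symmetric] sgn_1 mult_1_left simp_thms)
next
  assume R: ?R
  then have xy: "x \<in> framed_ngons n" "y \<in> framed_ngons n" "framed_coords x = framed_coords y"
    by simp_all
  obtain A where A: "A \<in> GL2R" "y = moebius_move A x"
    using xy by (rule framed_coords_eq_imp_moebius_move)
  have "sgn (det A) * framing_orientation (snd x) = framing_orientation (snd x)"
    using R framing_orientation_moebius_move[OF A(1) xy(1)] by (simp only: A(2))
  then have "det A > 0"
    using R framing_orientation_cases[of x n] by (auto simp: sgn_if split: if_splits)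
  then obtain k where k: "k \<noteq> 0" "k *\<^sub>R A \<in> SL2R"
    by (rule pos_det_scaleR_SL2R)
  then have "k *\<^sub>R A \<in> SL2R" "y = moebius_move (k *\<^sub>R A) x"
    by (simp_all only: A(2) moebius_move_scaleR[OF k(1)])
  then show "(x, y) \<in> orbit_rel SL2R n"
    unfolding orbit_rel_def mem_Collect_eq prod.case using xy(1,2) by blast
qed

lemma framed_coords_in_coord_tuples:
  assumes "x \<in> framed_ngons n"
  shows "framed_coords x \<in> coord_tuples n"
proof -
  obtain vs B where v: "vs \<in> vertex_lists n" "B \<in> GL2R" "x = (ngon_of vs, framing_of B)"
    using assms by (rule framed_ngonsE)
  let ?ws = "map (vec_act (matrix_inv B)) vs"
  have ws: "?ws \<in> vertex_lists n"
    by (rule vec_act_vertex_lists[OF matrix_inv_GL2R(3)[OF v(2)] v(1)])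
  have x: "framed_coords x = map coord_of ?ws"
    unfolding v(3) framed_coords_eq[OF v(2) vertex_lists_nonzero[OF v(1)]] by (simp add: comp_def)
  have "snd (coord_of w) > 0" if "w \<in> set ?ws" for w
    by (rule snd_coord_of_pos) (use that vertex_lists_nonzero[OF ws] in blast)
  then have "\<forall>(s, \<delta>)\<in>set (map coord_of ?ws). \<delta> > 0"
    unfolding set_map[of coord_of] by (simp add: case_prod_unfold)
  moreover have "map fst (map coord_of ?ws) = map proj ?ws" by simp
  then have "distinct (map fst (map coord_of ?ws))"
    using ws unfolding vertex_lists_def by (simp only: mem_Collect_eq)
  ultimately show ?thesis
    using v(1) unfolding x coord_tuples_def vertex_lists_def
    by (simp only: mem_Collect_eq length_map simp_thms)
qed

text \<open>
  Every framing can be prescribed: take vectors with the given coordinates and move them by \<open>B\<close>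
  together with the framing \<open>(0, \<infinity>, 1)\<close>.
\<close>
lemma framed_coords_surj:
  assumes cs: "cs \<in> coord_tuples n" and B: "B \<in> GL2R"
  obtains X where "(X, framing_of B) \<in> framed_ngons n" "framed_coords (X, framing_of B) = cs"
proof -
  have "\<exists>v. v \<noteq> 0 \<and> coord_of v = c" if "c \<in> set cs" for c
  proof -
    have "snd c > 0" using that cs by (auto simp: coord_tuples_def)
    then obtain v where "v \<noteq> 0" "coord_of v = (fst c, snd c)" by (rule coord_of_surj)
    then show ?thesis by (intro exI[of _ v]) simp
  qed
  then have "\<exists>f. \<forall>c\<in>set cs. f c \<noteq> 0 \<and> coord_of (f c) = c"
    by (intro bchoice ballI)
  then obtain f where f: "\<And>c. c \<in> set cs \<Longrightarrow> f c \<noteq> 0" "\<And>c. c \<in> set cs \<Longrightarrow> coord_of (f c) = c"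
    by blast
  define vs where "vs = map f cs"
  have cs': "map coord_of vs = cs"
    using f(2) by (simp add: vs_def map_idI)
  have proj: "map proj vs = map fst cs"
    unfolding cs'[symmetric] by simp
  have vs: "vs \<in> vertex_lists n"
  proof -
    have "0 \<notin> set vs" using f(1) by (auto simp: vs_def)
    moreover have "length vs = n" "distinct (map fst cs)"
      using cs by (simp_all add: coord_tuples_def vs_def)
    ultimately show ?thesis
      using proj by (simp only: vertex_lists_def mem_Collect_eq simp_thms)
  qed
  have *: "map (vec_act (matrix_inv B)) (map (vec_act B) vs) = vs"
    using B by (simp add: vec_act_mult[symmetric] matrix_inv_GL2R comp_def)
  have "framed_coords (ngon_of (map (vec_act B) vs), framing_of B) =
      map coord_of (map (vec_act (matrix_inv B)) (map (vec_act B) vs))"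
    unfolding framed_coords_eq[OF B vertex_lists_nonzero[OF vec_act_vertex_lists[OF B vs]]] by (simp add: comp_def)
  also have "\<dots> = cs" unfolding * cs' ..
  finally show thesis
    using that framed_ngonsI[OF vec_act_vertex_lists[OF B vs] B] by blast
qed

section \<open>The moduli spaces as fibres of the coordinates\<close>

text \<open>
  An invariant that separates the classes induces a bijection from the quotient to its range. It is
  applied once with all framed polygons, and once for each orientation of the framing.
\<close>
lemma bij_betw_quotient:
  assumes "\<And>x. x \<in> S \<Longrightarrow> r `` {x} = {y \<in> S. f y = f x}"
  shows "bij_betw (\<lambda>m. the_elem (f ` m)) (S // r) (f ` S)"
proof -
  have val: "the_elem (f ` r `` {x}) = f x" if "x \<in> S" for x
  proof -
    have "f ` r `` {x} = {f x}" using that assms[OF that] by auto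
    then show ?thesis by simp
  qed
  have "inj_on (\<lambda>m. the_elem (f ` m)) (S // r)"
  proof (rule inj_onI)
    fix m m' assume "m \<in> S // r" "m' \<in> S // r" and eq: "the_elem (f ` m) = the_elem (f ` m')"
    then obtain x y where xy: "x \<in> S" "y \<in> S" "m = r `` {x}" "m' = r `` {y}"
      by (elim quotientE)
    then have "f x = f y"
      using eq by (simp only: val)
    then show "m = m'"
      unfolding xy(3,4) assms[OF xy(1)] assms[OF xy(2)] by (simp only:)
  qed
  moreover have "(\<lambda>m. the_elem (f ` m)) ` (S // r) = f ` S"
  proof -
    have "S // r = (\<lambda>x. r `` {x}) ` S" by (auto simp: quotient_def)
    then show ?thesis
      by (simp add: image_image val)
  qed
  ultimately show ?thesis by (simp add: bij_betw_def)
qed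

lemma framed_coords_image:
  "framed_coords ` framed_ngons n = coord_tuples n"
  "\<sigma> \<in> {1, - 1} \<Longrightarrow> framed_coords ` {x \<in> framed_ngons n. framing_orientation (snd x) = \<sigma>} = coord_tuples n"
proof -
  have *: "framed_coords ` {x \<in> framed_ngons n. framing_orientation (snd x) = \<sigma>} = coord_tuples n"
    if "\<sigma> \<in> {1, - 1}" for \<sigma>
  proof (intro equalityI subsetI)
    fix cs assume cs: "cs \<in> coord_tuples n"
    \<comment> \<open>Its framing has orientation \<open>- sgn (- \<sigma>) = \<sigma>\<close>.\<close>
    define B where "B = mat2 (- \<sigma>) 0 0 1"
    have B: "B \<in> GL2R" "framing_orientation (framing_of B) = \<sigma>"
      using that framing_orientation_framing_of[of B] by (auto simp: B_def GL2R_def det_2)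
    obtain X where "(X, framing_of B) \<in> framed_ngons n" "framed_coords (X, framing_of B) = cs"
      using framed_coords_surj[OF cs B(1)] .
    then show "cs \<in> framed_coords ` {x \<in> framed_ngons n. framing_orientation (snd x) = \<sigma>}"
      using B(2) by force
  qed (auto intro: framed_coords_in_coord_tuples)
  show "\<sigma> \<in> {1, - 1} \<Longrightarrow> framed_coords ` {x \<in> framed_ngons n. framing_orientation (snd x) = \<sigma>} = coord_tuples n"
    by (rule *)
  show "framed_coords ` framed_ngons n = coord_tuples n"
    using *[of 1] framed_coords_in_coord_tuples by blast
qed

lemma orbit_SL2R:
  "x \<in> framed_ngons n \<Longrightarrow> orbit_rel SL2R n `` {x} =
    {y \<in> framed_ngons n. framed_coords y = framed_coords x \<and> framing_orientation (snd y) = framing_orientation (snd x)}"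
  by (auto simp: orbit_rel_SL2R_iff)

lemma moduli_part_eq:
  "moduli_part \<sigma> n = {x \<in> framed_ngons n. framing_orientation (snd x) = \<sigma>} // orbit_rel SL2R n"
proof -
  have "(\<forall>(X, F)\<in>orbit_rel SL2R n `` {x}. framing_orientation F = \<sigma>) \<longleftrightarrow> framing_orientation (snd x) = \<sigma>"
    if "x \<in> framed_ngons n" for x
    unfolding orbit_SL2R[OF that] using that by (auto simp only: case_prod_unfold)
  then show ?thesis
    unfolding moduli_part_def moduli_space_def quotient_def by blast
qed

lemma moduli_space_SL2R_eq: "moduli_space SL2R n = moduli_part 1 n \<union> moduli_part (- 1) n"
  unfolding moduli_part_eq moduli_space_def quotient_def using framing_orientation_cases by blast

lemma bij_betw_holographic_coords_part:
  assumes "\<sigma> \<in> {1, - 1}"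
  shows "bij_betw holographic_coords (moduli_part \<sigma> n) (coord_tuples n)"
proof -
  have "bij_betw (\<lambda>m. the_elem (framed_coords ` m)) (moduli_part \<sigma> n) (coord_tuples n)"
    unfolding moduli_part_eq framed_coords_image(2)[OF assms, of n, symmetric]
    by (rule bij_betw_quotient) (auto simp: orbit_SL2R)
  then show ?thesis unfolding holographic_coords_def .
qed

lemma bij_betw_holographic_coords_GL2R:
  "bij_betw holographic_coords (moduli_space GL2R n) (coord_tuples n)"
proof -
  have "bij_betw (\<lambda>m. the_elem (framed_coords ` m)) (moduli_space GL2R n) (coord_tuples n)"
    unfolding moduli_space_def framed_coords_image(1)[of n, symmetric]
    by (rule bij_betw_quotient) (auto simp: orbit_rel_GL2R_iff)
  then show ?thesis unfolding holographic_coords_def .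
qed

lemma holographic_coords_orbit:
  assumes "x \<in> framed_ngons n"
  shows "holographic_coords (orbit_rel SL2R n `` {x}) = framed_coords x"
proof -
  have "framed_coords ` orbit_rel SL2R n `` {x} = {framed_coords x}"
    using assms by (auto simp: orbit_SL2R)
  then show ?thesis by (simp add: holographic_coords_def)
qed

text \<open>
  An orbit consists of the translates of one of its points, and a map that commutes with the action
  carries them to the translates of the image point. This applies both to relabelling, which leaves
  the framing alone, and to reframing, which leaves the polygon alone.
\<close>
lemma image_orbit:
  assumes "x \<in> framed_ngons n" "\<And>y. y \<in> framed_ngons n \<Longrightarrow> f y \<in> framed_ngons n"
    and "\<And>A. A \<in> G \<Longrightarrow> f (moebius_move A x) = moebius_move A (f x)" "G \<subseteq> GL2R"
  shows "f ` orbit_rel G n `` {x} = orbit_rel G n `` {f x}"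
proof -
  have orbit: "orbit_rel G n `` {z} = {moebius_move A z |A. A \<in> G}" if z: "z \<in> framed_ngons n" for z
  proof -
    have "moebius_move A z \<in> framed_ngons n" if "A \<in> G" for A
      using that assms(4) by (intro moebius_move_in_framed_ngons[OF _ z]) blast
    then show ?thesis
      using z unfolding orbit_rel_def by blast
  qed
  have "f ` {moebius_move A x |A. A \<in> G} = {moebius_move A (f x) |A. A \<in> G}"
    unfolding Setcompr_eq_image image_image by (rule image_cong[OF refl]) (rule assms(3))
  then show ?thesis
    unfolding orbit[OF assms(1)] orbit[OF assms(2)[OF assms(1)]] .
qed

section \<open>Relabelling and the right action\<close>

lemma relabel_orbit:
  assumes \<pi>: "\<pi> permutes {..<n}" and x: "x \<in> framed_ngons n"
  shows "relabel \<pi> (orbit_rel SL2R n `` {x}) = orbit_rel SL2R n `` {apfst (apsnd (permute_list \<pi>)) x}"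
    and "apfst (apsnd (permute_list \<pi>)) x \<in> framed_ngons n"
    and "framed_coords (apfst (apsnd (permute_list \<pi>)) x) = permute_list \<pi> (framed_coords x)"
proof -
  let ?p = "apfst (apsnd (permute_list \<pi>)) :: framed \<Rightarrow> framed"
  have perm: "?p (ngon_of vs, framing_of B) = (ngon_of (permute_list \<pi> vs), framing_of B)"
    "permute_list \<pi> vs \<in> vertex_lists n" if "vs \<in> vertex_lists n" for vs B
  proof -
    have \<pi>': "\<pi> permutes {..<length vs}" using that \<pi> by (simp add: vertex_lists_def)
    show "?p (ngon_of vs, framing_of B) = (ngon_of (permute_list \<pi> vs), framing_of B)"
      using \<pi>' by (simp add: ngon_of_def permute_list_map)
    show "permute_list \<pi> vs \<in> vertex_lists n"
      using that distinct_permute_list[of \<pi> "map proj vs"] \<pi>'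
      by (simp add: vertex_lists_def permute_list_map[OF \<pi>'])
  qed
  have mem: "?p y \<in> framed_ngons n" if "y \<in> framed_ngons n" for y
    using that by (rule framed_ngonsE) (simp only: perm framed_ngonsI)
  then show "?p x \<in> framed_ngons n" using x .
  obtain vs B where v: "vs \<in> vertex_lists n" "B \<in> GL2R" "x = (ngon_of vs, framing_of B)"
    using x by (rule framed_ngonsE)
  have len: "length vs = n" using v(1) by (simp add: vertex_lists_def)
  have "?p (moebius_move A x) = moebius_move A (?p x)" if "A \<in> SL2R" for A
  proof -
    have A: "A \<in> GL2R" using that by (rule SL2R_subset_GL2R)
    show ?thesis
      unfolding v(3) perm(1)[OF v(1)] moebius_move_eq[OF A v(1,2)] moebius_move_eq[OF A perm(2)[OF v(1)] v(2)]
        perm(1)[OF vec_act_vertex_lists[OF A v(1)]]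
      using \<pi> len by (simp add: permute_list_map)
  qed
  then show "relabel \<pi> (orbit_rel SL2R n `` {x}) = orbit_rel SL2R n `` {?p x}"
    unfolding relabel_def using x mem SL2R_subset_GL2R by (intro image_orbit) blast+
  show "framed_coords (?p x) = permute_list \<pi> (framed_coords x)"
    unfolding v(3) perm(1)[OF v(1)] framed_coords_eq[OF v(2) vertex_lists_nonzero[OF perm(2)[OF v(1)]]]
      framed_coords_eq[OF v(2) vertex_lists_nonzero[OF v(1)]]
    using \<pi> len by (simp add: permute_list_map)
qed

lemma reframe_framing_of:
  assumes "A \<in> GL2R" "B \<in> GL2R"
  shows "reframe A (framing_of B) = framing_of (B ** A)"
  unfolding reframe_def
proof (rule the_equality)
  show "\<exists>B'\<in>GL2R. framing_of B = framing_of B' \<and> framing_of (B ** A) = framing_of (B' ** A)"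
    using assms by blast
next
  fix F assume "\<exists>B'\<in>GL2R. framing_of B = framing_of B' \<and> F = framing_of (B' ** A)"
  then obtain B' where B': "B' \<in> GL2R" "framing_of B = framing_of B'" "F = framing_of (B' ** A)" by blast
  obtain k where "k \<noteq> 0" "B' = k *\<^sub>R B"
    using framing_of_eq_imp_scalar[OF B'(2) assms(2) B'(1)] .
  then show "F = framing_of (B ** A)"
    using B'(3) by (simp add: scaleR_matrix_mult framing_of_scaleR)
qed

text \<open>
  Right multiplication of \<open>B\<close> by \<open>A\<close> commutes with left multiplication. This formula reduces all
  properties of the right action to those of matrix multiplication.
\<close>
lemma right_act_orbit:
  assumes A: "A \<in> SL2R" and v: "vs \<in> vertex_lists n" and B: "B \<in> GL2R"
  shows "right_act A (orbit_rel SL2R n `` {(ngon_of vs, framing_of B)}) =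
    orbit_rel SL2R n `` {(ngon_of vs, framing_of (B ** A))}"
proof -
  have A': "A \<in> GL2R" using A by (rule SL2R_subset_GL2R)
  have re: "apsnd (reframe A) (X, framing_of C) = (X, framing_of (C ** A))" if "C \<in> GL2R" for X C
    using A' that by (simp add: reframe_framing_of)
  have "apsnd (reframe A) ` orbit_rel SL2R n `` {(ngon_of vs, framing_of B)} =
    orbit_rel SL2R n `` {apsnd (reframe A) (ngon_of vs, framing_of B)}"
  proof (rule image_orbit)
    fix y assume "y \<in> framed_ngons n"
    then show "apsnd (reframe A) y \<in> framed_ngons n"
      by (rule framed_ngonsE) (simp only: re framed_ngonsI GL2R_mult A')
  next
    fix C assume "C \<in> SL2R"
    then have C: "C \<in> GL2R" by (rule SL2R_subset_GL2R)
    show "apsnd (reframe A) (moebius_move C (ngon_of vs, framing_of B)) =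
        moebius_move C (apsnd (reframe A) (ngon_of vs, framing_of B))"
      unfolding re[OF B] moebius_move_eq[OF C v B] moebius_move_eq[OF C v GL2R_mult[OF B A']]
        re[OF GL2R_mult[OF C B]] by (simp add: matrix_mul_assoc)
  qed (use v B SL2R_subset_GL2R in \<open>auto intro: framed_ngonsI\<close>)
  then show ?thesis
    unfolding right_act_def re[OF B] .
qed

lemma moduli_spaceE:
  assumes "m \<in> moduli_space SL2R n"
  obtains vs B where "vs \<in> vertex_lists n" "B \<in> GL2R" "m = orbit_rel SL2R n `` {(ngon_of vs, framing_of B)}"
  using assms unfolding moduli_space_def by (elim quotientE framed_ngonsE) blast

lemma orbit_in_moduli_space: "x \<in> framed_ngons n \<Longrightarrow> orbit_rel SL2R n `` {x} \<in> moduli_space SL2R n"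
  unfolding moduli_space_def by (rule quotientI)

lemma right_act_group:
  assumes m: "m \<in> moduli_space SL2R n"
  shows "right_act (mat 1) m = m"
    and "A \<in> SL2R \<Longrightarrow> right_act A m \<in> moduli_space SL2R n"
    and "A \<in> SL2R \<Longrightarrow> right_act (- A) m = right_act A m"
    and "A \<in> SL2R \<Longrightarrow> B \<in> SL2R \<Longrightarrow> right_act (A ** B) m = right_act B (right_act A m)"
proof -
  obtain vs C where v: "vs \<in> vertex_lists n" "C \<in> GL2R"
    and m: "m = orbit_rel SL2R n `` {(ngon_of vs, framing_of C)}"
    using m by (rule moduli_spaceE)
  show "right_act (mat 1) m = m"
    unfolding m right_act_orbit[OF mat_1_in_SL2R v] by (simp add: matrix_mul_rid)
  show "right_act A m \<in> moduli_space SL2R n" if "A \<in> SL2R"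
    unfolding m right_act_orbit[OF that v]
    by (rule orbit_in_moduli_space[OF framed_ngonsI[OF v(1) GL2R_mult[OF v(2) SL2R_subset_GL2R[OF that]]]])
  show "right_act (- A) m = right_act A m" if "A \<in> SL2R"
  proof -
    have "- A \<in> SL2R" using that by (simp add: SL2R_def det_2)
    moreover have "C ** - A = (- 1) *\<^sub>R (C ** A)"
      using scaleR_matrix_mult(2)[of C "- 1" A] by simp
    then have "framing_of (C ** - A) = framing_of (C ** A)"
      using framing_of_scaleR[of "- 1" "C ** A"] by simp
    ultimately show ?thesis
      unfolding m using that by (simp add: right_act_orbit v)
  qed
  show "right_act (A ** B) m = right_act B (right_act A m)" if A: "A \<in> SL2R" and B: "B \<in> SL2R"
    unfolding m right_act_orbit[OF A v] right_act_orbit[OF B v(1) GL2R_mult[OF v(2) SL2R_subset_GL2R[OF A]]]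
      right_act_orbit[OF SL2R_mult[OF A B] v] by (simp add: matrix_mul_assoc)
qed

text \<open>
  The inverse of \<open>A\<close> carries the framing of \<open>A\<close> back to \<open>(0, \<infinity>, 1)\<close> and the polygon along with it.
\<close>
lemma right_act_normalized:
  assumes A: "A \<in> SL2R" and X: "X \<in> decorated_ngons n"
  shows "right_act A (orbit_rel SL2R n `` {(X, framing_of (mat 1))}) =
    orbit_rel SL2R n `` {(decorated_act (matrix_inv A) X, framing_of (mat 1))}"
proof -
  obtain vs where vs: "vs \<in> vertex_lists n" and X: "X = ngon_of vs"
    using X unfolding decorated_ngons_eq by blast
  let ?A' = "matrix_inv A"
  have A': "A \<in> GL2R" "?A' \<in> SL2R" "?A' \<in> GL2R" "mat 1 \<in> GL2R"
    using A by (simp_all add: SL2R_subset_GL2R matrix_inv_SL2R mat_1_in_SL2R)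
  have "moebius_move ?A' (X, framing_of A) = (decorated_act ?A' X, framing_of (mat 1))"
    using A' by (simp add: framing_act_framing_of matrix_inv_GL2R)
  moreover have F: "(X, framing_of A) \<in> framed_ngons n"
    unfolding X using vs A'(1) by (rule framed_ngonsI)
  ultimately have F': "(decorated_act ?A' X, framing_of (mat 1)) \<in> framed_ngons n"
    and "((X, framing_of A), (decorated_act ?A' X, framing_of (mat 1))) \<in> orbit_rel SL2R n"
    using moebius_move_in_framed_ngons[OF A'(3) F] A'(2) unfolding orbit_rel_def by auto
  then have "orbit_rel SL2R n `` {(X, framing_of A)} =
      orbit_rel SL2R n `` {(decorated_act ?A' X, framing_of (mat 1))}"
    unfolding orbit_SL2R[OF F] orbit_SL2R[OF F'] orbit_rel_SL2R_iff by simp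
  then show ?thesis
    using right_act_orbit[OF A vs A'(4)] by (simp add: X matrix_mul_lid)
qed

text \<open>
  If \<open>w\<close> is the normalized vector of the horocycle, which is the inverse of \<open>B\<close> applied to the
  original one, then replacing \<open>B\<close> by \<open>B A\<close> applies the inverse matrix with rows \<open>(d, -b)\<close>,
  \<open>(-c, a)\<close> to \<open>w\<close>. Its first and second entries have quotient \<open>(d x - b) / (- c x + a)\<close>, and the
  second entry is multiplied by \<open>a - c x\<close>; as the diameter is the inverse square of this entry, it is
  divided by \<open>(a - c x)\<^sup>2\<close>.
\<close>
lemma right_act_coords:
  assumes "a * d - b * c = 1" and m: "m \<in> moduli_space SL2R n" and i: "i < n"
    and s: "holographic_coords m ! i = (s, \<delta>)"
    and s': "holographic_coords (right_act (mat2 a b c d) m) ! i = (s', \<delta>')"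
  shows "s' = rhat_act (mat2 d (- b) (- c) a) s"
    and "s = Some x \<Longrightarrow> a - c * x \<noteq> 0 \<Longrightarrow> \<delta>' = \<delta> / (a - c * x)\<^sup>2"
proof -
  define A where "A = mat2 a b c d"
  define A' where "A' = mat2 d (- b) (- c) a"
  have A: "A \<in> SL2R" "A \<in> GL2R" "A' \<in> GL2R" "det A' = 1"
    using assms(1) by (simp_all add: A_def A'_def SL2R_def GL2R_def det_2 mult.commute)
  have inv: "matrix_inv A = A'"
    unfolding A_def A'_def by (rule matrix_inv_mat2) fact
  obtain vs B where v: "vs \<in> vertex_lists n" "B \<in> GL2R"
    and m: "m = orbit_rel SL2R n `` {(ngon_of vs, framing_of B)}"
    using m by (rule moduli_spaceE)
  have nz: "0 \<notin> set vs" and len: "length vs = n" using v(1) by (simp_all add: vertex_lists_def)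
  define w where "w = vec_act (matrix_inv B) (vs ! i)"
  have "vs ! i \<noteq> 0" using nz len i nth_mem by metis
  then have w: "w \<noteq> 0" using v(2) by (simp add: w_def vec_act_nonzero matrix_inv_GL2R)
  have "holographic_coords m = map (\<lambda>v. coord_of (vec_act (matrix_inv B) v)) vs"
    unfolding m holographic_coords_orbit[OF framed_ngonsI[OF v]] by (rule framed_coords_eq[OF v(2) nz])
  then have c: "coord_of w = (s, \<delta>)"
    using s i len by (simp add: w_def)
  have BA: "B ** A \<in> GL2R" using v(2) A(2) by (rule GL2R_mult)
  have "holographic_coords (right_act A m) = map (\<lambda>v. coord_of (vec_act (matrix_inv (B ** A)) v)) vs"
    unfolding m right_act_orbit[OF A(1) v] holographic_coords_orbit[OF framed_ngonsI[OF v(1) BA]]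
    by (rule framed_coords_eq[OF BA nz])
  then have c': "coord_of (vec_act A' w) = (s', \<delta>')"
    using s' i len by (simp add: w_def A_def[symmetric] matrix_inv_mult[OF v(2) A(2)] inv vec_act_mult)
  have "s' = proj (vec_act A' w)" "s = proj w"
    using c c' fst_coord_of by (metis fst_conv)+
  then show "s' = rhat_act (mat2 d (- b) (- c) a) s"
    using A(3) w by (simp add: proj_vec_act A'_def)
  show "\<delta>' = \<delta> / (a - c * x)\<^sup>2" if "s = Some x" "a - c * x \<noteq> 0"
  proof -
    have w2: "w$2 \<noteq> 0" "x = w$1 / w$2"
      using \<open>s = proj w\<close> that(1) by (auto simp: proj_def split: if_splits)
    \<comment> \<open>No factor comes from the normalization, as the determinant is 1.\<close>
    have "vec_act A' w $ 2 = w$2 * (a - c * x)"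
      using A(4) w2 by (simp add: vec_act_def matrix_vector_mult_nth_2 A'_def algebra_simps)
    then show ?thesis
      using c c' w2(1) that(2) by (auto simp: coord_of_def power_mult_distrib)
  qed
qed

theorem theorem2p5:
  fixes n :: nat
  assumes "n \<ge> 3"
  shows
    \<comment> \<open>the coordinates parametrize the moduli space\<close>
    "(\<forall>G\<in>{SL2R, GL2R}. framed_coords respects (orbit_rel G n)) \<and>
     moduli_space SL2R n = moduli_part 1 n \<union> moduli_part (- 1) n \<and>
     (\<forall>\<sigma>\<in>{1, - 1}. bij_betw holographic_coords (moduli_part \<sigma> n) (coord_tuples n)) \<and>
     bij_betw holographic_coords (moduli_space GL2R n) (coord_tuples n) \<and>
     (\<forall>m\<in>moduli_space SL2R n. \<forall>\<pi>. \<pi> permutes {..<n} \<longrightarrow>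
        relabel \<pi> m \<in> moduli_space SL2R n \<and>
        holographic_coords (relabel \<pi> m) = permute_list \<pi> (holographic_coords m)) \<and>
     \<comment> \<open>right action on the moduli space\<close>
     (\<forall>m\<in>moduli_space SL2R n.
        right_act (mat 1) m = m \<and>
        (\<forall>A\<in>SL2R. right_act A m \<in> moduli_space SL2R n \<and> right_act (- A) m = right_act A m \<and>
           (\<forall>B\<in>SL2R. right_act (A ** B) m = right_act B (right_act A m)))) \<and>
     (\<forall>A\<in>SL2R. \<forall>X\<in>decorated_ngons n.
        right_act A (orbit_rel SL2R n `` {(X, framing_of (mat 1))}) =
          orbit_rel SL2R n `` {(decorated_act (matrix_inv A) X, framing_of (mat 1))}) \<and>
     \<comment> \<open>its expression in coordinates\<close>
     (\<forall>a b c d :: real. a * d - b * c = 1 \<longrightarrow>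
        (\<forall>m\<in>moduli_space SL2R n. \<forall>i<n. \<forall>s \<delta> s' \<delta>'.
           holographic_coords m ! i = (s, \<delta>) \<longrightarrow>
           holographic_coords (right_act (mat2 a b c d) m) ! i = (s', \<delta>') \<longrightarrow>
           s' = rhat_act (mat2 d (- b) (- c) a) s \<and>
           (\<forall>x. s = Some x \<longrightarrow> a - c * x \<noteq> 0 \<longrightarrow>
              s' = Some ((d * x - b) / (- c * x + a)) \<and>
              \<delta>' = \<delta> / (a - c * x)\<^sup>2 \<and>
              ((\<lambda>t. (d * t - b) / (- c * t + a)) has_real_derivative 1 / (a - c * x)\<^sup>2) (at x))))"
proof (intro conjI)
  show "\<forall>G\<in>{SL2R, GL2R}. framed_coords respects (orbit_rel G n)"
    by (auto intro!: congruentI simp: orbit_rel_SL2R_iff orbit_rel_GL2R_iff)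
next
  show "\<forall>m\<in>moduli_space SL2R n. \<forall>\<pi>. \<pi> permutes {..<n} \<longrightarrow>
        relabel \<pi> m \<in> moduli_space SL2R n \<and>
        holographic_coords (relabel \<pi> m) = permute_list \<pi> (holographic_coords m)"
  proof (intro ballI allI impI)
    fix m \<pi> assume "m \<in> moduli_space SL2R n" and \<pi>: "\<pi> permutes {..<n}"
    then obtain x where x: "x \<in> framed_ngons n" "m = orbit_rel SL2R n `` {x}"
      by (auto simp: moduli_space_def elim: quotientE)
    show "relabel \<pi> m \<in> moduli_space SL2R n \<and>
        holographic_coords (relabel \<pi> m) = permute_list \<pi> (holographic_coords m)"
      unfolding x(2) relabel_orbit(1)[OF \<pi> x(1)] holographic_coords_orbit[OF x(1)]
        holographic_coords_orbit[OF relabel_orbit(2)[OF \<pi> x(1)]]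
      using relabel_orbit(2,3)[OF \<pi> x(1)] by (simp add: orbit_in_moduli_space)
  qed
next
  show "\<forall>m\<in>moduli_space SL2R n.
        right_act (mat 1) m = m \<and>
        (\<forall>A\<in>SL2R. right_act A m \<in> moduli_space SL2R n \<and> right_act (- A) m = right_act A m \<and>
           (\<forall>B\<in>SL2R. right_act (A ** B) m = right_act B (right_act A m)))"
    by (intro ballI conjI right_act_group)
next
  show "\<forall>a b c d :: real. a * d - b * c = 1 \<longrightarrow>
        (\<forall>m\<in>moduli_space SL2R n. \<forall>i<n. \<forall>s \<delta> s' \<delta>'.
           holographic_coords m ! i = (s, \<delta>) \<longrightarrow>
           holographic_coords (right_act (mat2 a b c d) m) ! i = (s', \<delta>') \<longrightarrow>
           s' = rhat_act (mat2 d (- b) (- c) a) s \<and>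
           (\<forall>x. s = Some x \<longrightarrow> a - c * x \<noteq> 0 \<longrightarrow>
              s' = Some ((d * x - b) / (- c * x + a)) \<and>
              \<delta>' = \<delta> / (a - c * x)\<^sup>2 \<and>
              ((\<lambda>t. (d * t - b) / (- c * t + a)) has_real_derivative 1 / (a - c * x)\<^sup>2) (at x)))"
  proof (intro allI impI ballI)
    fix a b c d :: real and m i s \<delta> s' \<delta>'
    assume det: "a * d - b * c = 1"
      and *: "m \<in> moduli_space SL2R n" "i < n" "holographic_coords m ! i = (s, \<delta>)"
        "holographic_coords (right_act (mat2 a b c d) m) ! i = (s', \<delta>')"
    have s': "s' = rhat_act (mat2 d (- b) (- c) a) s"
      by (rule right_act_coords(1)[OF det *])
    moreover have "s' = Some ((d * x - b) / (- c * x + a))" "\<delta>' = \<delta> / (a - c * x)\<^sup>2"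
      "((\<lambda>t. (d * t - b) / (- c * t + a)) has_real_derivative 1 / (a - c * x)\<^sup>2) (at x)"
      if x: "s = Some x" "a - c * x \<noteq> 0" for x
    proof -
      show "s' = Some ((d * x - b) / (- c * x + a))"
        using x(2) by (simp add: s' x(1) rhat_act_def)
      show "\<delta>' = \<delta> / (a - c * x)\<^sup>2"
        by (rule right_act_coords(2)[OF det * x])
      have "(d * (- c * x + a) - (d * x - b) * (- c)) = 1"
        using det by (simp add: algebra_simps)
      moreover have "((\<lambda>t. (d * t - b) / (- c * t + a)) has_real_derivative
          (d * (- c * x + a) - (d * x - b) * (- c)) / ((- c * x + a) * (- c * x + a))) (at x)"
        using x(2) by (auto intro!: derivative_eq_intros)
      ultimately show "((\<lambda>t. (d * t - b) / (- c * t + a)) has_real_derivative 1 / (a - c * x)\<^sup>2) (at x)"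
        by (simp add: power2_eq_square)
    qed
    ultimately show "s' = rhat_act (mat2 d (- b) (- c) a) s \<and>
           (\<forall>x. s = Some x \<longrightarrow> a - c * x \<noteq> 0 \<longrightarrow>
              s' = Some ((d * x - b) / (- c * x + a)) \<and>
              \<delta>' = \<delta> / (a - c * x)\<^sup>2 \<and>
              ((\<lambda>t. (d * t - b) / (- c * t + a)) has_real_derivative 1 / (a - c * x)\<^sup>2) (at x))"
      by blast
  qed
qed (use moduli_space_SL2R_eq bij_betw_holographic_coords_part bij_betw_holographic_coords_GL2R
    right_act_normalized in blast)+

end
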